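(* Let $X,Y\subset\mathbb{R}^n$ be closed semialgebraic sets of dimension $k$. Let $f:X\to Y$ be a bi-Lipschitz homeomorphism (not assumed semialgebraic). If $n\ge 4k+2$, then $f$ can be extended to a tame bi-Lipschitz homeomorphism $F:\mathbb{R}^n\to\mathbb{R}^n$. Moreover, there is a continuous family of tame bi-Lipschitz homeomorphisms $F_t:\mathbb{R}^n\to\mathbb{R}^n$, $t\in\mathbb{R}$ (that is, the map $\mathbb{R}^n\times\mathbb{R}\ni(x,t)\mapsto F_t(x)\in\mathbb{R}^n$ is continuous), such that $F_0$ is the identity and $F_1|_X=f$.
   Context: Subsets of $\mathbb{R}^n$ carry the outer metric, i.e. the restriction of the Euclidean distance. A bi-Lipschitz homeomorphism is a bijection which is Lipschitz together with its inverse. A bi-Lipschitz homeomorphism of $\mathbb{R}^n$ is called tame if it is a composition of bi-Lipschitz homeomorphisms of the form $(x_1,\dots,x_n)\mapsto(x_1,\dots,x_{n-1},x_n+p(x_1,\dots,x_{n-1}))$ and linear mappings of $\mathbb{R}^n$ with determinant one. *)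

theory Defs
  imports "HOL-Analysis.Analysis" "HOL-Algebra.QuotRing"
begin

section \<open>Semialgebraic sets\<close>

definition basic_semialgebraic :: "'a::euclidean_space set \<Rightarrow> bool" where
  "basic_semialgebraic S \<longleftrightarrow>
     (\<exists>P Q. finite P \<and> finite Q \<and>
        (\<forall>p\<in>P \<union> Q. real_polynomial_function p) \<and>
        S = {x. (\<forall>p\<in>P. p x = 0) \<and> (\<forall>q\<in>Q. 0 < q x)})"

definition semialgebraic :: "'a::euclidean_space set \<Rightarrow> bool" where
  "semialgebraic S \<longleftrightarrow>
     (\<exists>\<F>. finite \<F> \<and> (\<forall>B\<in>\<F>. basic_semialgebraic B) \<and> S = \<Union>\<F>)"


section \<open>Dimension of a semialgebraic set\<close>

text \<open>
  As in Bochnak--Coste--Roy, Real Algebraic Geometry, Section 2.8, the dimension of a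
  semialgebraic set is the Krull dimension of the quotient of the polynomial ring
  by the ideal of the polynomials vanishing on the set.  Since the reals form an infinite
  field, polynomials are identified with polynomial functions.
\<close>

definition polynomial_function_ring :: "('a::euclidean_space \<Rightarrow> real) ring" where
  "polynomial_function_ring =
     \<lparr>carrier = {p. real_polynomial_function p},
      mult = (\<lambda>p q x. p x * q x), one = (\<lambda>x. 1),
      zero = (\<lambda>x. 0), add = (\<lambda>p q x. p x + q x)\<rparr>"

definition vanishing_ideal :: "'a::euclidean_space set \<Rightarrow> ('a \<Rightarrow> real) set" where
  "vanishing_ideal S = {p. real_polynomial_function p \<and> (\<forall>x\<in>S. p x = 0)}"

text \<open>
  The supremum is taken in the extended reals, so that the zero ring, which has no prime
  ideals, gets dimension \<open>-\<infinity>\<close>; in particular the empty set has dimension \<open>-\<infinity>\<close>, not \<open>0\<close>.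
\<close>

definition krull_dim :: "('a, 'b) ring_scheme \<Rightarrow> ereal" where
  "krull_dim R =
     Sup {ereal (real d) | d. \<exists>\<pp> :: nat \<Rightarrow> 'a set.
            (\<forall>i\<le>d. primeideal (\<pp> i) R) \<and> (\<forall>i<d. \<pp> i \<subset> \<pp> (Suc i))}"

definition semialgebraic_dim :: "'a::euclidean_space set \<Rightarrow> ereal" where
  "semialgebraic_dim S = krull_dim (polynomial_function_ring Quot vanishing_ideal S)"

lemma cring_polynomial_function_ring:
  "cring (polynomial_function_ring :: ('a::euclidean_space \<Rightarrow> real) ring)"
proof (rule cringI)
  show "abelian_group (polynomial_function_ring :: ('a \<Rightarrow> real) ring)"
  proof (rule abelian_groupI)
    fix p :: "'a \<Rightarrow> real"
    assume "p \<in> carrier polynomial_function_ring"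
    then have "(\<lambda>x. - p x) \<in> carrier polynomial_function_ring"
      by (auto simp: polynomial_function_ring_def)
    then show "\<exists>q\<in>carrier polynomial_function_ring.
        q \<oplus>\<^bsub>polynomial_function_ring\<^esub> p = \<zero>\<^bsub>polynomial_function_ring\<^esub>"
      by (rule rev_bexI) (simp add: polynomial_function_ring_def)
  qed (auto simp: polynomial_function_ring_def)
  show "comm_monoid (polynomial_function_ring :: ('a \<Rightarrow> real) ring)"
    by (rule comm_monoidI) (auto simp: polynomial_function_ring_def mult_ac)
qed (auto simp: polynomial_function_ring_def distrib_right)

lemma ideal_vanishing_ideal:
  fixes S :: "'a::euclidean_space set"
  shows "ideal (vanishing_ideal S) polynomial_function_ring"
proof -
  interpret cring "polynomial_function_ring :: ('a \<Rightarrow> real) ring"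
    by (rule cring_polynomial_function_ring)
  have neg: "\<ominus>\<^bsub>polynomial_function_ring\<^esub> p = (\<lambda>x. - p x)"
    if "real_polynomial_function p" for p :: "'a \<Rightarrow> real"
    by (rule minus_equality) (use that in \<open>auto simp: polynomial_function_ring_def\<close>)
  show ?thesis
  proof (rule idealI)
    show "subgroup (vanishing_ideal S) (add_monoid polynomial_function_ring)"
    proof (rule add.subgroupI)
      show "vanishing_ideal S \<noteq> {}"
        by (auto simp: vanishing_ideal_def intro!: exI[of _ "\<lambda>x. 0"])
      show "\<ominus>\<^bsub>polynomial_function_ring\<^esub> p \<in> vanishing_ideal S"
        if "p \<in> vanishing_ideal S" for p
        using that by (auto simp: vanishing_ideal_def neg)
    qed (auto simp: vanishing_ideal_def polynomial_function_ring_def)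
  qed (use ring_axioms in \<open>auto simp: vanishing_ideal_def polynomial_function_ring_def\<close>)
qed


section \<open>Bi-Lipschitz homeomorphisms and tameness\<close>

text \<open>The values of \<open>f\<close> outside \<open>X\<close> are irrelevant.\<close>

definition bilipschitz_homeomorphism ::
    "'a::metric_space set \<Rightarrow> 'b::metric_space set \<Rightarrow> ('a \<Rightarrow> 'b) \<Rightarrow> bool" where
  "bilipschitz_homeomorphism X Y f \<longleftrightarrow>
     bij_betw f X Y \<and> (\<exists>C. C-lipschitz_on X f) \<and> (\<exists>C. C-lipschitz_on Y (inv_into X f))"

text \<open>
  The linear order on the index type enumerates the coordinates
  \<open>x\<^sub>1, \<dots>, x\<^sub>n\<close>, so that \<open>x\<^sub>n\<close> is the coordinate with the largest index.
\<close>

definition last_index :: "'n::{finite,linorder}" where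
  "last_index = Max UNIV"

text \<open>
  A function of \<open>x\<^sub>1, \<dots>, x\<^bsub>n-1\<^esub>\<close> is encoded as a function \<open>p\<close> on all of
  \<open>\<real>\<^sup>n\<close> that does not depend on \<open>x\<^sub>n\<close>.
\<close>

definition last_coordinate_shear ::
    "(real^'n::{finite,linorder} \<Rightarrow> real^'n::{finite,linorder}) \<Rightarrow> bool" where
  "last_coordinate_shear F \<longleftrightarrow>
     (\<exists>p :: real^'n::{finite,linorder} \<Rightarrow> real.
        (\<forall>x y. (\<forall>i. i \<noteq> last_index \<longrightarrow> x $ i = y $ i) \<longrightarrow> p x = p y) \<and>
        F = (\<lambda>x. \<chi> i. if i = last_index then x $ i + p x else x $ i))"

inductive tame_composition :: "(real^'n::{finite,linorder} \<Rightarrow> real^'n::{finite,linorder}) \<Rightarrow> bool" where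
  shear: "last_coordinate_shear F \<Longrightarrow> bilipschitz_homeomorphism UNIV UNIV F \<Longrightarrow> tame_composition F"
| linear: "linear L \<Longrightarrow> det (matrix L) = 1 \<Longrightarrow> tame_composition L"
| comp: "tame_composition F \<Longrightarrow> tame_composition G \<Longrightarrow> tame_composition (F \<circ> G)"

definition tame_bilipschitz :: "(real^'n::{finite,linorder} \<Rightarrow> real^'n::{finite,linorder}) \<Rightarrow> bool" where
  "tame_bilipschitz F \<longleftrightarrow> bilipschitz_homeomorphism UNIV UNIV F \<and> tame_composition F"

end

theory Submission
  imports Defs "HOL-Library.Function_Algebras"
begin

text \<open>
  Let \<open>Z = X \<union> Y\<close>.  The dimension \<open>k\<close> controls how many independent polynomial functions of
  given degree there are on \<open>Z\<close>; a count of dimensions then yields equations for the differences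
  \<open>x - y\<close> of points of \<open>Z\<close>, and these suffice to embed \<open>Z\<close> by a linear projection.

  \<^bold>\<open>Dimension bounds growth.\<close>  If the coordinate ring of a set has Krull dimension at most
  \<open>k\<close>, then the restrictions to the set of the polynomials of degree at most \<open>m\<close> span
  a space of dimension \<open>O(m ^ k)\<close> (\<open>poly_growth_of_semialgebraic_dim\<close>).  Noether
  normalization gives a subspace \<open>U\<close> such that no nonzero polynomial in the linear forms
  of \<open>U\<close> vanishes on the set, while the coordinate ring is, with control of degrees, a finite
  module over these polynomials; so the growth is \<open>O(m ^ dim U)\<close>.  A going-up argument
  produces a chain of \<open>dim U + 1\<close> prime ideals, whence \<open>dim U \<le> k\<close>.

  \<^bold>\<open>Secants.\<close>  For a form \<open>G\<close> of degree \<open>m\<close> the function \<open>(x, y) \<mapsto> G (x - y)\<close> on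
  \<open>Z \<times> Z\<close> lies in a space of dimension \<open>O(m ^ (2 * k))\<close>, but in \<open>d\<close> variables there are about
  \<open>m ^ (d - 1)\<close> monomials of degree \<open>m\<close>.  Hence for \<open>d \<ge> 2 * k + 2\<close> some nonzero form vanishes on
  all differences \<open>x - y\<close> (\<open>homogeneous_equation_of_secants\<close>).  A direction on which the form does
  not vanish has positive distance from all secant directions, limits included, so that projecting
  along it is bi-Lipschitz on \<open>Z\<close>.  By iteration, the orthogonal projection along a subspace
  \<open>W\<close> of codimension \<open>2 * k + 1\<close> is bi-Lipschitz on \<open>Z\<close>
  (\<open>subspace_avoiding_secants_exists\<close>).

  \<^bold>\<open>Shears.\<close>  Let \<open>V\<close> be the orthogonal complement of \<open>W\<close>, with projections \<open>P\<close> onto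
  \<open>V\<close> and \<open>Q\<close> onto \<open>W\<close>.  Since \<open>n \<ge> 4 * k + 2\<close>, there is a linear isometric embedding
  \<open>j\<close> of \<open>V\<close> into \<open>W\<close>.  Three shears, alternately along \<open>W\<close>, \<open>V\<close> and \<open>W\<close>, with Lipschitz
  extensions as data, move
  \<open>x = P x + Q x\<close> to \<open>P x + j (P (f x))\<close>, to \<open>P (f x) + j (P (f x))\<close>, and finally to
  \<open>P (f x) + Q (f x) = f x\<close>.  A shear along a subspace is tame because it is a composition of
  shears in single directions, each conjugate by a rotation to a shear of the last coordinate.
  Multiplying the displacements of the three shears by \<open>t\<close> yields the isotopy.
\<close>

section \<open>Prime ideals in a subring\<close>

text \<open>
  Subrings of a commutative ring type, and ideals and prime ideals of such a subring \<open>P\<close>.  Ideals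
  are subsets of \<open>P\<close>, closed under multiplication by elements of \<open>P\<close> only.
\<close>

definition subring_of :: "'r::comm_ring_1 set \<Rightarrow> bool" where
  "subring_of P \<longleftrightarrow> 1 \<in> P \<and> (\<forall>a\<in>P. \<forall>b\<in>P. a - b \<in> P \<and> a * b \<in> P)"

definition ideal_of :: "'r::comm_ring_1 set \<Rightarrow> 'r set \<Rightarrow> bool" where
  "ideal_of P J \<longleftrightarrow> J \<subseteq> P \<and> 0 \<in> J \<and> (\<forall>a\<in>J. \<forall>b\<in>J. a + b \<in> J) \<and> (\<forall>r\<in>P. \<forall>a\<in>J. r * a \<in> J)"

definition prime_of :: "'r::comm_ring_1 set \<Rightarrow> 'r set \<Rightarrow> bool" where
  "prime_of P J \<longleftrightarrow> ideal_of P J \<and> 1 \<notin> J \<and> (\<forall>a\<in>P. \<forall>b\<in>P. a * b \<in> J \<longrightarrow> a \<in> J \<or> b \<in> J)"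

lemma subring_ofD:
  assumes "subring_of P"
  shows "1 \<in> P" "0 \<in> P" "\<And>a b. a \<in> P \<Longrightarrow> b \<in> P \<Longrightarrow> a - b \<in> P"
    "\<And>a b. a \<in> P \<Longrightarrow> b \<in> P \<Longrightarrow> a * b \<in> P" "\<And>a. a \<in> P \<Longrightarrow> - a \<in> P"
    "\<And>a b. a \<in> P \<Longrightarrow> b \<in> P \<Longrightarrow> a + b \<in> P"
proof -
  have *: "1 \<in> P" "\<And>a b. a \<in> P \<Longrightarrow> b \<in> P \<Longrightarrow> a - b \<in> P \<and> a * b \<in> P"
    using assms by (auto simp: subring_of_def)
  show "1 \<in> P" "\<And>a b. a \<in> P \<Longrightarrow> b \<in> P \<Longrightarrow> a - b \<in> P" "\<And>a b. a \<in> P \<Longrightarrow> b \<in> P \<Longrightarrow> a * b \<in> P"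
    using * by auto
  show z: "0 \<in> P" using *(2)[of 1 1] *(1) by simp
  show m: "- a \<in> P" if "a \<in> P" for a using *(2)[of 0 a] that z by simp
  show "a + b \<in> P" if "a \<in> P" "b \<in> P" for a b using *(2)[of a "- b"] that m by simp
qed

lemma ideal_ofD:
  assumes "ideal_of P J"
  shows "\<And>a. a \<in> J \<Longrightarrow> a \<in> P" "0 \<in> J" "\<And>a b. a \<in> J \<Longrightarrow> b \<in> J \<Longrightarrow> a + b \<in> J"
    "\<And>r a. r \<in> P \<Longrightarrow> a \<in> J \<Longrightarrow> r * a \<in> J"
  using assms by (auto simp: ideal_of_def)

lemma ideal_of_diff:
  assumes "subring_of P" "ideal_of P J" "a \<in> J" "b \<in> J"
  shows "a - b \<in> J"
proof -
  have "(- 1) * b \<in> J"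
    using ideal_ofD(4)[OF assms(2), of "-1" b] subring_ofD(1,5)[OF assms(1)] assms(4) by blast
  then show ?thesis using ideal_ofD(3)[OF assms(2) assms(3)] by fastforce
qed

lemma ideal_of_sum:
  assumes "ideal_of P J" "\<And>i. i \<in> A \<Longrightarrow> f i \<in> J"
  shows "(\<Sum>i\<in>A. f i) \<in> J"
  using assms(2) by (induction A rule: infinite_finite_induct) (auto intro: ideal_ofD[OF assms(1)])

lemma ideal_of_extend:
  assumes P: "subring_of P" and J: "ideal_of P J" and u: "u \<in> P"
  shows "ideal_of P {a + u * r | a r. a \<in> J \<and> r \<in> P}"
    and "J \<subseteq> {a + u * r | a r. a \<in> J \<and> r \<in> P}" and "u \<in> {a + u * r | a r. a \<in> J \<and> r \<in> P}"
proof -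
  let ?J = "{a + u * r | a r. a \<in> J \<and> r \<in> P}"
  note Pd = subring_ofD[OF P] and Jd = ideal_ofD[OF J]
  have mem: "a + u * r \<in> ?J" if "a \<in> J" "r \<in> P" for a r using that by blast
  have "x + y \<in> ?J" if "x \<in> ?J" "y \<in> ?J" for x y
  proof -
    from that obtain a r b s
      where *: "x = a + u * r" "a \<in> J" "r \<in> P" "y = b + u * s" "b \<in> J" "s \<in> P"
      by auto
    have "x + y = (a + b) + u * (r + s)" by (simp add: * algebra_simps)
    also have "\<dots> \<in> ?J" using * Jd(3) Pd(6) by (intro mem) auto
    finally show ?thesis .
  qed
  moreover have "t * x \<in> ?J" if "t \<in> P" "x \<in> ?J" for t x
  proof -
    from that(2) obtain a r where *: "x = a + u * r" "a \<in> J" "r \<in> P" by blast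
    have "t * x = t * a + u * (t * r)" by (simp add: * algebra_simps)
    also have "\<dots> \<in> ?J" using * that(1) Jd(4) Pd(4) by (intro mem) auto
    finally show ?thesis .
  qed
  moreover have "0 \<in> ?J" using mem[OF Jd(2) Pd(2)] by simp
  moreover have "?J \<subseteq> P" using Jd(1) Pd(4,6) u by auto
  ultimately show "ideal_of P ?J" unfolding ideal_of_def by blast
  show "J \<subseteq> ?J" using mem[OF _ Pd(2)] by auto
  show "u \<in> ?J" using mem[OF Jd(2) Pd(1)] by simp
qed

text \<open>Krull's lemma: an ideal maximal among those disjoint from a multiplicative set is prime.\<close>

lemma prime_of_avoiding_exists:
  assumes P: "subring_of P" and J: "ideal_of P J"
    and S: "S \<subseteq> P" "1 \<in> S" "\<And>s t. s \<in> S \<Longrightarrow> t \<in> S \<Longrightarrow> s * t \<in> S" "J \<inter> S = {}"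
  obtains Q where "prime_of P Q" "J \<subseteq> Q" "Q \<inter> S = {}"
proof -
  let ?A = "{Q. ideal_of P Q \<and> J \<subseteq> Q \<and> Q \<inter> S = {}}"
  note Pd = subring_ofD[OF P]
  have "\<exists>M\<in>?A. \<forall>X\<in>?A. M \<subseteq> X \<longrightarrow> X = M"
  proof (rule subset_Zorn_nonempty)
    show "?A \<noteq> {}" using J S(4) by blast
    fix C assume C: "C \<noteq> {}" "subset.chain ?A C"
    have CA: "C \<subseteq> ?A" and tot: "\<And>X Y. X \<in> C \<Longrightarrow> Y \<in> C \<Longrightarrow> X \<subseteq> Y \<or> Y \<subseteq> X"
      using C(2) by (auto simp: subset_chain_def)
    have "ideal_of P (\<Union>C)"
      unfolding ideal_of_def
    proof (intro conjI ballI)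
      show "\<Union>C \<subseteq> P" using CA ideal_ofD(1) by blast
      show "0 \<in> \<Union>C" using C(1) CA ideal_ofD(2) by blast
      fix a b assume "a \<in> \<Union>C" "b \<in> \<Union>C"
      then obtain X Y where XY: "X \<in> C" "Y \<in> C" "a \<in> X" "b \<in> Y" by blast
      then show "a + b \<in> \<Union>C" using tot[OF XY(1,2)] CA ideal_ofD(3) by blast
    next
      fix r a assume "r \<in> P" "a \<in> \<Union>C"
      then show "r * a \<in> \<Union>C" using CA ideal_ofD(4) by blast
    qed
    then show "\<Union>C \<in> ?A" using C(1) CA by blast
  qed
  then obtain M where M: "ideal_of P M" "J \<subseteq> M" "M \<inter> S = {}"
    and max: "\<And>X. ideal_of P X \<Longrightarrow> M \<subseteq> X \<Longrightarrow> X \<inter> S = {} \<Longrightarrow> X = M"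
    by fastforce
  note Md = ideal_ofD[OF M(1)]
  \<comment> \<open>By maximality, adjoining any \<open>a \<notin> M\<close> produces an element of \<open>S\<close>.\<close>
  have ex: "\<exists>m r. m \<in> M \<and> r \<in> P \<and> m + a * r \<in> S" if "a \<in> P" "a \<notin> M" for a
  proof -
    note e = ideal_of_extend[OF P M(1) that(1)]
    have "{m + a * r | m r. m \<in> M \<and> r \<in> P} \<inter> S \<noteq> {}"
      using max[OF e(1,2)] e(3) that(2) by auto
    then show ?thesis by blast
  qed
  have "a \<in> M \<or> b \<in> M" if ab: "a \<in> P" "b \<in> P" "a * b \<in> M" for a b
  proof (rule ccontr)
    assume "\<not> (a \<in> M \<or> b \<in> M)"
    then obtain m r n s where *: "m \<in> M" "r \<in> P" "m + a * r \<in> S" "n \<in> M" "s \<in> P" "n + b * s \<in> S"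
      using ex ab(1,2) by meson
    have "(m + a * r) * (n + b * s) = (n + b * s) * m + (a * r) * n + (r * s) * (a * b)"
      by (simp add: algebra_simps)
    also have "\<dots> \<in> M"
      by (intro Md(3) Md(4) Pd(4,6) * ab Md(1)[OF *(4)])
    finally show False using S(3)[OF *(3,6)] M(3) by blast
  qed
  then have "prime_of P M" unfolding prime_of_def using M S(2) by blast
  then show thesis using that M by blast
qed

text \<open>
  The elimination behind the going-up step; it replaces the determinant trick.  If modulo an
  ideal every generator, multiplied by an element of \<open>T\<close>, is \<open>u\<close> times a combination of the
  generators, then a single element of \<open>T\<close> annihilates all generators.
\<close>

lemma annihilator_by_elimination:
  fixes P :: "'r::comm_ring_1 set"
  assumes P: "subring_of P" and R: "subring_of R" "R \<subseteq> P" and J: "ideal_of P J" and u: "u \<in> R"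
    and T: "T \<subseteq> R" "1 \<in> T" "\<And>s t. s \<in> T \<Longrightarrow> t \<in> T \<Longrightarrow> s * t \<in> T"
      "\<And>t r. t \<in> T \<Longrightarrow> r \<in> R \<Longrightarrow> t - u * r \<in> T"
    and "finite E" "E \<subseteq> P"
    and "\<And>e. e \<in> E \<Longrightarrow> \<exists>t\<in>T. \<exists>M. (\<forall>e'\<in>E. M e' \<in> R) \<and> t * e - u * (\<Sum>e'\<in>E. M e' * e') \<in> J"
  shows "\<exists>D\<in>T. \<forall>e\<in>E. D * e \<in> J"
  using assms(10-)
proof (induction E rule: finite_induct)
  case empty
  then show ?case using T(2) by blast
next
  case (insert a E)
  note Rd = subring_ofD[OF R(1)] and Jd = ideal_ofD[OF J] and Pd = subring_ofD[OF P]
  obtain ta Ma where a: "ta \<in> T" "\<And>e. e \<in> insert a E \<Longrightarrow> Ma e \<in> R"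
    "ta * a - u * (\<Sum>e'\<in>insert a E. Ma e' * e') \<in> J"
    using insert.prems(2)[of a] by auto
  define \<delta> where "\<delta> = ta - u * Ma a"
  have \<delta>: "\<delta> \<in> T" unfolding \<delta>_def using T(4) a(1,2) by blast
  have "ta * a - u * (\<Sum>e'\<in>insert a E. Ma e' * e') = \<delta> * a - u * (\<Sum>e'\<in>E. Ma e' * e')"
    using insert.hyps by (simp add: \<delta>_def algebra_simps)
  with a(3) have a': "\<delta> * a - u * (\<Sum>e'\<in>E. Ma e' * e') \<in> J" by simp
  have "\<exists>t\<in>T. \<exists>M. (\<forall>e'\<in>E. M e' \<in> R) \<and> t * e - u * (\<Sum>e'\<in>E. M e' * e') \<in> J" if "e \<in> E" for e
  proof -
    obtain t M where t: "t \<in> T" "\<And>e. e \<in> insert a E \<Longrightarrow> M e \<in> R"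
      "t * e - u * (\<Sum>e'\<in>insert a E. M e' * e') \<in> J"
      using insert.prems(2)[of e] \<open>e \<in> E\<close> by auto
    define N where "N = (\<lambda>e'. \<delta> * M e' + u * M a * Ma e')"
    have N: "N e' \<in> R" if "e' \<in> E" for e'
      unfolding N_def using \<delta> T(1) t(2) a(2) that u by (intro Rd) auto
    have "\<delta> * (t * e - u * (\<Sum>e'\<in>insert a E. M e' * e'))
        + (u * M a) * (\<delta> * a - u * (\<Sum>e'\<in>E. Ma e' * e')) \<in> J"
      using t a' \<delta> T(1) u R(2) by (intro Jd(3) Jd(4) Pd(4)) auto
    also have "\<delta> * (t * e - u * (\<Sum>e'\<in>insert a E. M e' * e'))
        + (u * M a) * (\<delta> * a - u * (\<Sum>e'\<in>E. Ma e' * e'))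
        = (\<delta> * t) * e - u * (\<Sum>e'\<in>E. N e' * e')"
      using insert.hyps by (simp add: N_def algebra_simps sum.distrib sum_distrib_left)
    finally show ?thesis using N T(3)[OF \<delta> t(1)] by blast
  qed
  then obtain D where D: "D \<in> T" "\<And>e. e \<in> E \<Longrightarrow> D * e \<in> J"
    using insert.IH insert.prems(1) by blast
  have DP: "D \<in> P" "\<delta> \<in> P" using D \<delta> T(1) R(2) by auto
  have sumJ: "(u * (\<Sum>e'\<in>E. Ma e' * (D * e'))) \<in> J"
  proof (intro Jd(4)[of u] ideal_of_sum[OF J])
    show "u \<in> P" using u R(2) by blast
    show "Ma e' * (D * e') \<in> J" if "e' \<in> E" for e'
      by (rule Jd(4)) (use a(2)[of e'] D(2)[OF that] R(2) that in auto)
  qed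
  have "D * (\<delta> * a - u * (\<Sum>e'\<in>E. Ma e' * e')) + u * (\<Sum>e'\<in>E. Ma e' * (D * e')) \<in> J"
    by (rule Jd(3)[OF Jd(4)[OF DP(1) a'] sumJ])
  also have "D * (\<delta> * a - u * (\<Sum>e'\<in>E. Ma e' * e')) + u * (\<Sum>e'\<in>E. Ma e' * (D * e'))
     = (D * \<delta>) * a"
    by (simp add: algebra_simps sum_distrib_left)
  finally have "(D * \<delta>) * a \<in> J" .
  moreover have "(D * \<delta>) * e \<in> J" if "e \<in> E" for e
    using Jd(4)[OF DP(2) D(2)[OF that]] by (simp add: algebra_simps)
  ultimately show ?case using T(3)[OF D(1) \<delta>] by blast
qed

section \<open>Polynomial functions in the linear forms of a subspace\<close>

text \<open>
  \<open>poly_deg U m p\<close>: the function \<open>p\<close> is a polynomial of total degree at most \<open>m\<close> in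
  the linear forms \<open>x \<mapsto> v \<bullet> x\<close> with \<open>v \<in> U\<close>.
\<close>

inductive poly_deg :: "'a::euclidean_space set \<Rightarrow> nat \<Rightarrow> ('a \<Rightarrow> real) \<Rightarrow> bool" for U where
  const: "poly_deg U m (\<lambda>x. c)"
| add: "poly_deg U m p \<Longrightarrow> poly_deg U m q \<Longrightarrow> poly_deg U m (\<lambda>x. p x + q x)"
| lin: "poly_deg U m p \<Longrightarrow> v \<in> U \<Longrightarrow> poly_deg U (Suc m) (\<lambda>x. (v \<bullet> x) * p x)"

lemma poly_deg_Suc: "poly_deg U m p \<Longrightarrow> poly_deg U (Suc m) p"
  by (induction rule: poly_deg.induct) (auto intro: poly_deg.intros)

lemma poly_deg_mono: "poly_deg U m p \<Longrightarrow> m \<le> n \<Longrightarrow> poly_deg U n p"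
  by (induction n) (auto simp: le_Suc_eq intro: poly_deg_Suc)

lemma poly_deg_mono_set: "poly_deg U m p \<Longrightarrow> U \<subseteq> V \<Longrightarrow> poly_deg V m p"
  by (induction rule: poly_deg.induct) (auto intro: poly_deg.intros)

lemma poly_deg_cmult: "poly_deg U m p \<Longrightarrow> poly_deg U m (\<lambda>x. c * p x)"
proof (induction rule: poly_deg.induct)
  case (lin m p v)
  then show ?case using poly_deg.lin[OF lin.IH lin.hyps(2)] by (simp add: mult.left_commute)
qed (auto simp: distrib_left intro: poly_deg.intros)

lemma poly_deg_mult: "poly_deg U m p \<Longrightarrow> poly_deg U n q \<Longrightarrow> poly_deg U (m + n) (\<lambda>x. p x * q x)"
proof (induction rule: poly_deg.induct)
  case (const m c)
  then show ?case by (auto intro: poly_deg_cmult poly_deg_mono)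
next
  case (lin m p v)
  then show ?case using poly_deg.lin[OF lin.IH[OF lin.prems] lin.hyps(2)] by (simp add: mult.assoc)
qed (auto simp: distrib_right intro: poly_deg.intros)

lemma poly_deg_diff: "poly_deg U m p \<Longrightarrow> poly_deg U m q \<Longrightarrow> poly_deg U m (\<lambda>x. p x - q x)"
  using poly_deg.add[OF _ poly_deg_cmult[of U m q "-1"]] by simp

lemma poly_deg_sum:
  "(\<And>i. i \<in> A \<Longrightarrow> poly_deg U m (f i)) \<Longrightarrow> poly_deg U m (\<lambda>x. \<Sum>i\<in>A. f i x)"
  by (induction A rule: infinite_finite_induct) (auto intro: poly_deg.intros)

lemma poly_deg_power: "v \<in> U \<Longrightarrow> poly_deg U m (\<lambda>x. (v \<bullet> x) ^ m)"
  by (induction m) (auto intro: poly_deg.intros)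

lemma poly_deg_imp_real_polynomial_function:
  "poly_deg U m p \<Longrightarrow> real_polynomial_function p"
  by (induction rule: poly_deg.induct) (auto intro: bounded_linear_inner_right)

lemma real_polynomial_function_imp_poly_deg:
  fixes p :: "'a::euclidean_space \<Rightarrow> real"
  shows "real_polynomial_function p \<Longrightarrow> \<exists>m. poly_deg UNIV m p"
proof (induction rule: real_polynomial_function.induct)
  case (linear f)
  then interpret bounded_linear f .
  define v where "v = (\<Sum>b\<in>Basis. f b *\<^sub>R b)"
  have "f x = (v \<bullet> x) * 1" for x
  proof -
    have "f x = f (\<Sum>b\<in>Basis. (x \<bullet> b) *\<^sub>R b)" by (simp add: euclidean_representation)
    also have "\<dots> = v \<bullet> x"
      by (simp add: sum scale v_def inner_sum_left inner_commute[of x] mult.commute)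
    finally show ?thesis by simp
  qed
  then have "f = (\<lambda>x. (v \<bullet> x) * 1)" by blast
  then show ?case using poly_deg.lin[OF poly_deg.const, of v UNIV 0 1] by auto
next
  case (add f g)
  then obtain m n where "poly_deg UNIV m f" "poly_deg UNIV n g" by blast
  then have "poly_deg UNIV (max m n) (\<lambda>x. f x + g x)"
    by (intro poly_deg.add) (auto intro: poly_deg_mono)
  then show ?case by blast
qed (auto intro: poly_deg.const poly_deg_mult)

lemma poly_deg_orthogonal_invariant:
  assumes "poly_deg U m p" "\<And>v. v \<in> U \<Longrightarrow> v \<bullet> z = 0"
  shows "p (x + z) = p x"
  using assms by (induction rule: poly_deg.induct) (auto simp: inner_add_right)

text \<open>The ring of all polynomials in the linear forms of \<open>U\<close>.\<close>

definition poly_ring :: "'a::euclidean_space set \<Rightarrow> ('a \<Rightarrow> real) set" where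
  "poly_ring U = {p. \<exists>m. poly_deg U m p}"

lemma poly_ring_UNIV: "poly_ring UNIV = {p :: 'a::euclidean_space \<Rightarrow> real. real_polynomial_function p}"
  using poly_deg_imp_real_polynomial_function real_polynomial_function_imp_poly_deg
  by (auto simp: poly_ring_def)

lemma subring_of_poly_ring: "subring_of (poly_ring U)"
  unfolding subring_of_def
proof (intro conjI ballI)
  show "1 \<in> poly_ring U" using poly_deg.const[of U 0 1] by (auto simp: poly_ring_def one_fun_def)
  fix p q assume "p \<in> poly_ring U" "q \<in> poly_ring U"
  then obtain m n where "poly_deg U m p" "poly_deg U n q" by (auto simp: poly_ring_def)
  then have "poly_deg U (max m n) (\<lambda>x. p x - q x)" "poly_deg U (m + n) (\<lambda>x. p x * q x)"
    by (auto intro!: poly_deg_diff poly_deg_mult intro: poly_deg_mono)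
  then show "p - q \<in> poly_ring U" "p * q \<in> poly_ring U"
    by (auto simp: poly_ring_def fun_diff_def times_fun_def)
qed

lemma poly_ring_mono: "U \<subseteq> V \<Longrightarrow> poly_ring U \<subseteq> poly_ring V"
  by (auto simp: poly_ring_def intro: poly_deg_mono_set)

lemma linear_form_in_poly_ring: "u \<in> U \<Longrightarrow> (\<lambda>x. u \<bullet> x) \<in> poly_ring U"
  using poly_deg_power[of u U 1] by (auto simp: poly_ring_def)

lemma real_polynomial_function_mult_eq_zeroD:
  fixes p q :: "'a::euclidean_space \<Rightarrow> real"
  assumes "real_polynomial_function p" "real_polynomial_function q" "\<And>x. p x * q x = 0"
  shows "(\<forall>x. p x = 0) \<or> (\<forall>x. q x = 0)"
proof (rule ccontr)
  assume "\<not> ?thesis"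
  then obtain a b where ab: "p a \<noteq> 0" "q b \<noteq> 0" by blast
  \<comment> \<open>Restrict both factors to the line through \<open>a\<close> and \<open>b\<close>.\<close>
  define l where "l = (\<lambda>s::real. a + s *\<^sub>R (b - a))"
  have l: "polynomial_function l"
    unfolding l_def
    by (intro polynomial_function_add polynomial_function_const polynomial_function_bounded_linear
        bounded_linear_scaleR_left)
  have fin: "finite {s. g (l s) = 0}" if "real_polynomial_function g" "g (l s0) \<noteq> 0" for g s0
  proof -
    have "real_polynomial_function (g \<circ> l)"
      using real_polynomial_function_compose[OF l that(1)] .
    then obtain c n where c: "g \<circ> l = (\<lambda>x. \<Sum>i\<le>n. c i * x ^ i)"
      using real_polynomial_function_iff_sum by blast
    then have c': "g (l s) = (\<Sum>i\<le>n. c i * s ^ i)" for s by (metis comp_apply)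
    have "\<exists>i\<le>n. c i \<noteq> 0"
    proof (rule ccontr)
      assume "\<not> (\<exists>i\<le>n. c i \<noteq> 0)"
      then have "g (l s0) = 0" by (simp add: c')
      then show False using that by simp
    qed
    then show ?thesis unfolding c' polyfun_finite_roots .
  qed
  have "finite {s. p (l s) = 0}" "finite {s. q (l s) = 0}"
    using fin[OF assms(1), of 0] fin[OF assms(2), of 1] ab by (auto simp: l_def)
  moreover have "{s. p (l s) = 0} \<union> {s. q (l s) = 0} = UNIV"
    using assms(3) by fastforce
  ultimately show False
    by (metis finite_UnI infinite_UNIV_char_0)
qed

lemma poly_ring_real_polynomial_function: "p \<in> poly_ring U \<Longrightarrow> real_polynomial_function p"
  by (auto simp: poly_ring_def intro: poly_deg_imp_real_polynomial_function)

lemma poly_ring_mult_eq_zeroD: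
  assumes "p \<in> poly_ring U" "q \<in> poly_ring V" "p * q = 0"
  shows "p = 0 \<or> q = 0"
proof -
  have "p x * q x = 0" for x using fun_cong[OF assms(3), of x] by simp
  then have "(\<forall>x. p x = 0) \<or> (\<forall>x. q x = 0)"
    by (intro real_polynomial_function_mult_eq_zeroD poly_ring_real_polynomial_function[OF assms(1)]
        poly_ring_real_polynomial_function[OF assms(2)])
  then show ?thesis by (auto simp: fun_eq_iff)
qed

text \<open>The orthogonal complement of the vector \<open>u\<close> inside \<open>U\<close>.\<close>

abbreviation orth_in :: "'a::euclidean_space set \<Rightarrow> 'a \<Rightarrow> 'a set" where
  "orth_in U u \<equiv> {x \<in> U. u \<bullet> x = 0}"

lemma subspace_orth_in: "subspace U \<Longrightarrow> subspace (orth_in U u)"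
  by (auto simp: subspace_def inner_add_right)

lemma orth_in_part: "subspace U \<Longrightarrow> u \<in> U \<Longrightarrow> norm u = 1 \<Longrightarrow> v \<in> U \<Longrightarrow> v - (u \<bullet> v) *\<^sub>R u \<in> orth_in U u"
  by (auto simp: subspace_diff subspace_scale inner_diff_right norm_eq_1)

lemma dim_orth_in:
  assumes "subspace U" "u \<in> U" "norm u = 1"
  shows "dim (orth_in U u) = dim U - 1"
proof -
  have "dim {y \<in> U. \<forall>x\<in>span {u}. orthogonal x y} + dim (span {u}) = dim U"
    using assms by (intro dim_subspace_orthogonal_to_vectors) (auto simp: span_minimal)
  moreover have "{y \<in> U. \<forall>x\<in>span {u}. orthogonal x y} = orth_in U u"
    by (auto simp: span_singleton orthogonal_def intro: span_base)
  moreover have "dim (span {u}) = 1" using assms(3) by (auto simp: dim_insert)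
  ultimately show ?thesis by simp
qed

text \<open>Every polynomial is, modulo the linear form \<open>u\<close>, a polynomial in the remaining variables.\<close>

lemma poly_ring_split:
  assumes U: "subspace U" "u \<in> U" "norm u = 1" and "p \<in> poly_ring U"
  obtains q r where "q \<in> poly_ring (orth_in U u)" "r \<in> poly_ring U" "p = q + (\<lambda>x. u \<bullet> x) * r"
proof -
  let ?U = "orth_in U u" and ?l = "\<lambda>x. u \<bullet> x"
  have R: "subring_of (poly_ring V)" for V :: "'a set" by (rule subring_of_poly_ring)
  note Rd = subring_ofD[OF R]
  have sub: "poly_ring ?U \<subseteq> poly_ring U" by (rule poly_ring_mono) auto
  obtain m where "poly_deg U m p" using assms(4) by (auto simp: poly_ring_def)
  then have "\<exists>q r. q \<in> poly_ring ?U \<and> r \<in> poly_ring U \<and> p = q + ?l * r"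
  proof (induction rule: poly_deg.induct)
    case (const m c)
    have "(\<lambda>x. c) \<in> poly_ring ?U" by (auto simp: poly_ring_def intro: poly_deg.const)
    moreover have "(\<lambda>x::'a. c) = (\<lambda>x. c) + ?l * 0" by simp
    ultimately show ?case using Rd(2) by blast
  next
    case (add m p q)
    then obtain p1 p2 q1 q2 where *: "p1 \<in> poly_ring ?U" "p2 \<in> poly_ring U" "p = p1 + ?l * p2"
      "q1 \<in> poly_ring ?U" "q2 \<in> poly_ring U" "q = q1 + ?l * q2" by blast
    have "(\<lambda>x. p x + q x) = (p1 + q1) + ?l * (p2 + q2)"
      by (auto simp: * fun_eq_iff algebra_simps)
    then show ?case using * Rd(6) by blast
  next
    case (lin m p v)
    then obtain q r where *: "q \<in> poly_ring ?U" "r \<in> poly_ring U" "p = q + ?l * r" by blast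
    define v' where "v' = v - (u \<bullet> v) *\<^sub>R u"
    have v': "v' \<in> ?U" unfolding v'_def by (rule orth_in_part[OF U lin.hyps(2)])
    have pU: "p \<in> poly_ring U" using lin.hyps by (auto simp: poly_ring_def)
    have cU: "(\<lambda>x. (u \<bullet> v)) \<in> poly_ring U" by (auto simp: poly_ring_def intro: poly_deg.const)
    have "v \<bullet> x = v' \<bullet> x + (u \<bullet> v) * (u \<bullet> x)" for x
      by (simp add: v'_def inner_diff_left)
    then have "(\<lambda>x. (v \<bullet> x) * p x) = (\<lambda>x. v' \<bullet> x) * q + ?l * ((\<lambda>x. v' \<bullet> x) * r + (\<lambda>x. u \<bullet> v) * p)"
      by (auto simp: * fun_eq_iff algebra_simps)
    moreover have "(\<lambda>x. v' \<bullet> x) * q \<in> poly_ring ?U"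
      using Rd(4) linear_form_in_poly_ring[OF v'] * by blast
    moreover have "(\<lambda>x. v' \<bullet> x) * r + (\<lambda>x. u \<bullet> v) * p \<in> poly_ring U"
      using Rd(4,6) linear_form_in_poly_ring[of v' U] v' * cU pU by auto
    ultimately show ?case by blast
  qed
  then show thesis using that by blast
qed

text \<open>The value of a polynomial in the linear forms of \<open>orth_in U u\<close> does not change along \<open>u\<close>.\<close>

lemma poly_ring_orth_in_project:
  assumes "p \<in> poly_ring (orth_in U u)"
  shows "p (x - s *\<^sub>R u) = p x"
proof -
  obtain m where "poly_deg (orth_in U u) m p" using assms by (auto simp: poly_ring_def)
  from poly_deg_orthogonal_invariant[OF this, of "- s *\<^sub>R u" x] show ?thesis
    by (simp add: inner_commute)
qed

section \<open>A chain of primes over a finite extension of a polynomial ring\<close>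

text \<open>
  If the polynomial ring is, modulo \<open>J\<close>, a finite module over \<open>poly_ring U\<close>, and
  \<open>poly_ring U\<close> embeds modulo \<open>J\<close>, then adding the linear form \<open>u\<close> to \<open>J\<close> does not
  destroy the embedding of the polynomial ring with one variable less.
\<close>

lemma extend_ideal_by_linear_form:
  fixes U :: "'a::euclidean_space set"
  assumes U: "subspace U" "u \<in> U" "norm u = 1"
    and J: "ideal_of (poly_ring UNIV) J"
    and E: "finite E" "E \<subseteq> poly_ring UNIV"
    and fin: "\<And>p. p \<in> poly_ring UNIV \<Longrightarrow>
      \<exists>q. (\<forall>e\<in>E. q e \<in> poly_ring U) \<and> p - (\<Sum>e\<in>E. q e * e) \<in> J"
    and inj: "\<And>p. p \<in> poly_ring U \<Longrightarrow> p \<in> J \<Longrightarrow> p = 0"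
    and s: "s \<in> poly_ring (orth_in U u)"
      "s \<in> {a + (\<lambda>x. u \<bullet> x) * r | a r. a \<in> J \<and> r \<in> poly_ring UNIV}"
  shows "s = 0"
proof (rule ccontr)
  assume "s \<noteq> 0"
  let ?l = "\<lambda>x. u \<bullet> x" and ?R = "poly_ring U" and ?P = "poly_ring (UNIV :: 'a set)"
  note P = subring_of_poly_ring[of "UNIV :: 'a set"] and R = subring_of_poly_ring[of U]
  note Pd = subring_ofD[OF P] and Rd = subring_ofD[OF R] and Jd = ideal_ofD[OF J]
  have RP: "?R \<subseteq> ?P" by (rule poly_ring_mono) auto
  have lR: "?l \<in> ?R" by (rule linear_form_in_poly_ring[OF U(2)])
  \<comment> \<open>The polynomials that are nonzero modulo the linear form \<open>u\<close>; they form a multiplicative set.\<close>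
  define T where "T = {t \<in> ?R. \<exists>x. u \<bullet> x = 0 \<and> t x \<noteq> 0}"
  have sR: "s \<in> ?R" using s(1) poly_ring_mono[of "orth_in U u" U] by auto
  obtain y where y: "s y \<noteq> 0" using \<open>s \<noteq> 0\<close> by (auto simp: fun_eq_iff)
  have "s (y - (u \<bullet> y) *\<^sub>R u) \<noteq> 0" "u \<bullet> (y - (u \<bullet> y) *\<^sub>R u) = 0"
    using y U(3) by (auto simp: poly_ring_orth_in_project[OF s(1)] inner_diff_right norm_eq_1)
  then have sT: "s \<in> T" unfolding T_def using sR by blast
  have Tmult: "a * b \<in> T" if ab: "a \<in> T" "b \<in> T" for a b
  proof -
    obtain a1 a2 where a: "a1 \<in> poly_ring (orth_in U u)" "a2 \<in> ?R" "a = a1 + ?l * a2"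
      using poly_ring_split[OF U] ab(1) unfolding T_def by blast
    obtain b1 b2 where b: "b1 \<in> poly_ring (orth_in U u)" "b2 \<in> ?R" "b = b1 + ?l * b2"
      using poly_ring_split[OF U] ab(2) unfolding T_def by blast
    have "a1 \<noteq> 0" "b1 \<noteq> 0" using ab a(3) b(3) by (auto simp: T_def)
    then have "a1 * b1 \<noteq> 0" using poly_ring_mult_eq_zeroD[OF a(1) b(1)] by blast
    then obtain z where z: "a1 z * b1 z \<noteq> 0" by (auto simp: fun_eq_iff)
    let ?z = "z - (u \<bullet> z) *\<^sub>R u"
    have 0: "u \<bullet> ?z = 0" using U(3) by (simp add: inner_diff_right norm_eq_1)
    have "(a * b) ?z \<noteq> 0"
      using z 0 by (simp add: a(3) b(3) poly_ring_orth_in_project[OF a(1)]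
          poly_ring_orth_in_project[OF b(1)])
    moreover have "a * b \<in> ?R" using ab Rd(4) by (auto simp: T_def)
    ultimately show ?thesis using 0 unfolding T_def by blast
  qed
  have T1: "1 \<in> T" using Rd(1) by (auto simp: T_def intro: exI[of _ 0])
  have Tl: "t - ?l * r \<in> T" if "t \<in> T" "r \<in> ?R" for t r
  proof -
    have "t - ?l * r \<in> ?R" using that lR Rd by (auto simp: T_def)
    then show ?thesis using that(1) by (auto simp: T_def)
  qed
  obtain a r where ar: "a \<in> J" "r \<in> ?P" "s = a + ?l * r" using s(2) by blast
  \<comment> \<open>Modulo \<open>J\<close>, multiplication by \<open>s\<close> maps each generator to \<open>u\<close> times a combination of generators.\<close>
  have "\<exists>D\<in>T. \<forall>e\<in>E. D * e \<in> J"
  proof (rule annihilator_by_elimination[OF P R RP J lR _ T1 Tmult Tl E])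
    show "T \<subseteq> ?R" by (auto simp: T_def)
    fix e assume e: "e \<in> E"
    have "r * e \<in> ?P" using ar(2) e E(2) Pd(4) by blast
    then obtain M where M: "\<forall>e\<in>E. M e \<in> ?R" "r * e - (\<Sum>e\<in>E. M e * e) \<in> J"
      using fin by blast
    have "e * a + ?l * (r * e - (\<Sum>e\<in>E. M e * e)) \<in> J"
      using M e E(2) ar(1) lR RP by (intro Jd(3,4)) auto
    also have "e * a + ?l * (r * e - (\<Sum>e\<in>E. M e * e)) = s * e - ?l * (\<Sum>e\<in>E. M e * e)"
      by (simp add: ar(3) algebra_simps)
    finally show "\<exists>t\<in>T. \<exists>M. (\<forall>e'\<in>E. M e' \<in> ?R) \<and> t * e - ?l * (\<Sum>e'\<in>E. M e' * e') \<in> J"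
      using sT M(1) by blast
  qed
  then obtain D where D: "D \<in> T" "\<And>e. e \<in> E \<Longrightarrow> D * e \<in> J" by blast
  \<comment> \<open>The generators span \<open>1\<close> modulo \<open>J\<close>, so \<open>D\<close> itself lies in \<open>J\<close>.\<close>
  obtain q where q: "\<forall>e\<in>E. q e \<in> ?R" "1 - (\<Sum>e\<in>E. q e * e) \<in> J" using fin[OF Pd(1)] by blast
  have "(\<Sum>e\<in>E. q e * (D * e)) \<in> J"
    by (rule ideal_of_sum[OF J], rule Jd(4)) (use D(2) q(1) RP in auto)
  then have "D * (1 - (\<Sum>e\<in>E. q e * e)) + (\<Sum>e\<in>E. q e * (D * e)) \<in> J"
    using D(1) q(2) RP by (intro Jd(3) Jd(4)) (auto simp: T_def)
  also have "D * (1 - (\<Sum>e\<in>E. q e * e)) + (\<Sum>e\<in>E. q e * (D * e)) = D"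
    by (simp add: algebra_simps sum_distrib_left)
  finally have "D = 0" using inj D(1) by (auto simp: T_def)
  then show False using D(1) by (simp add: T_def)
qed

text \<open>
  By induction on \<open>dim U\<close>: take a prime over \<open>J\<close> that meets \<open>poly_ring U\<close> only in zero, then
  add a linear form of \<open>U\<close> to it and continue with one variable less.
\<close>

lemma prime_chain_exists:
  fixes U :: "'a::euclidean_space set"
  assumes "subspace U" "ideal_of (poly_ring UNIV) J" and E: "finite E" "E \<subseteq> poly_ring UNIV"
    and "\<And>p. p \<in> poly_ring UNIV \<Longrightarrow>
      \<exists>q. (\<forall>e\<in>E. q e \<in> poly_ring U) \<and> p - (\<Sum>e\<in>E. q e * e) \<in> J"
    and "\<And>p. p \<in> poly_ring U \<Longrightarrow> p \<in> J \<Longrightarrow> p = 0"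
  shows "\<exists>\<pp> :: nat \<Rightarrow> ('a \<Rightarrow> real) set. (\<forall>i\<le>dim U. prime_of (poly_ring UNIV) (\<pp> i)) \<and>
    (\<forall>i<dim U. \<pp> i \<subset> \<pp> (Suc i)) \<and> J \<subseteq> \<pp> 0"
  using assms(1,2,5,6)
proof (induction "dim U" arbitrary: U J)
  case 0
  note P = subring_of_poly_ring[of "UNIV :: 'a set"] and R = subring_of_poly_ring[of U]
  have "(1 :: 'a \<Rightarrow> real) \<noteq> 0" by simp
  then have "1 \<notin> J" using 0(5)[of 1] subring_ofD(1)[OF R] by blast
  then obtain Q where "prime_of (poly_ring UNIV) Q" "J \<subseteq> Q"
    using prime_of_avoiding_exists[OF P 0(3), of "{1}"] subring_ofD(1)[OF P] by auto
  then show ?case unfolding 0(1)[symmetric] by (intro exI[of _ "\<lambda>_. Q"]) auto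
next
  case (Suc d)
  let ?P = "poly_ring (UNIV :: 'a set)"
  note P = subring_of_poly_ring[of "UNIV :: 'a set"] and R = subring_of_poly_ring[of U]
  note Pd = subring_ofD[OF P] and Rd = subring_ofD[OF R]
  have RP: "poly_ring U \<subseteq> ?P" by (rule poly_ring_mono) auto
  have "poly_ring U - {0} \<subseteq> ?P" "1 \<in> poly_ring U - {0}" "J \<inter> (poly_ring U - {0}) = {}"
    using RP Rd(1) Suc.prems(4) by (auto simp: fun_eq_iff)
  moreover have "a * b \<in> poly_ring U - {0}" if "a \<in> poly_ring U - {0}" "b \<in> poly_ring U - {0}" for a b
    using that poly_ring_mult_eq_zeroD[of a U b U] Rd(4) by blast
  ultimately obtain Q where Q: "prime_of ?P Q" "J \<subseteq> Q" "Q \<inter> (poly_ring U - {0}) = {}"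
    using prime_of_avoiding_exists[OF P Suc.prems(2), of "poly_ring U - {0}"] by metis
  have Qi: "ideal_of ?P Q" using Q(1) by (auto simp: prime_of_def)
  obtain B where B: "B \<subseteq> U" "\<And>x. x \<in> B \<Longrightarrow> norm x = 1" "card B = dim U"
    using orthonormal_basis_subspace[OF Suc.prems(1)] by metis
  then obtain u where u: "u \<in> U" "norm u = 1"
    using Suc.hyps(2) by (metis card.empty equals0I nat.distinct(1) subsetD)
  define l where "l = (\<lambda>x. u \<bullet> x)"
  have lU: "l \<in> poly_ring U" unfolding l_def by (rule linear_form_in_poly_ring[OF u(1)])
  then have lP: "l \<in> ?P" using RP by blast
  define K where "K = {a + l * r | a r. a \<in> Q \<and> r \<in> ?P}"
  note ext = ideal_of_extend[OF P Qi lP, folded K_def]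
  let ?U = "orth_in U u"
  have "\<exists>\<pp> :: nat \<Rightarrow> ('a \<Rightarrow> real) set. (\<forall>i\<le>dim ?U. prime_of ?P (\<pp> i)) \<and>
    (\<forall>i<dim ?U. \<pp> i \<subset> \<pp> (Suc i)) \<and> K \<subseteq> \<pp> 0"
  proof (rule Suc.hyps(1))
    show "d = dim ?U" using dim_orth_in[OF Suc.prems(1) u] Suc.hyps(2) by simp
    show "subspace ?U" by (rule subspace_orth_in[OF Suc.prems(1)])
    show "ideal_of ?P K" by (rule ext)
  next
    fix p assume "p \<in> ?P"
    then obtain q where q: "\<forall>e\<in>E. q e \<in> poly_ring U" "p - (\<Sum>e\<in>E. q e * e) \<in> J"
      using Suc.prems(3) by blast
    have "\<exists>a b. a \<in> poly_ring ?U \<and> b \<in> poly_ring U \<and> q e = a + l * b" if "e \<in> E" for e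
      using poly_ring_split[OF Suc.prems(1) u] q(1) that unfolding l_def by metis
    then obtain a b where ab: "\<And>e. e \<in> E \<Longrightarrow> a e \<in> poly_ring ?U \<and> b e \<in> poly_ring U \<and> q e = a e + l * b e"
      by metis
    have "(p - (\<Sum>e\<in>E. q e * e)) + (\<Sum>e\<in>E. (b e * e) * l) \<in> K"
    proof (intro ideal_ofD(3)[OF ext(1)] ideal_of_sum[OF ext(1)])
      show "p - (\<Sum>e\<in>E. q e * e) \<in> K" using q(2) Q(2) ext(2) by blast
      show "b e * e * l \<in> K" if "e \<in> E" for e
        using ideal_ofD(4)[OF ext(1)] ext(3) ab[OF that] that E(2) RP Pd(4) by blast
    qed
    moreover have "(\<Sum>e\<in>E. q e * e) = (\<Sum>e\<in>E. a e * e) + (\<Sum>e\<in>E. (b e * e) * l)"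
      unfolding sum.distrib[symmetric] by (rule sum.cong) (auto simp: ab algebra_simps)
    then have "(p - (\<Sum>e\<in>E. q e * e)) + (\<Sum>e\<in>E. (b e * e) * l) = p - (\<Sum>e\<in>E. a e * e)"
      by (simp add: fun_eq_iff)
    ultimately have "p - (\<Sum>e\<in>E. a e * e) \<in> K" by simp
    then show "\<exists>q. (\<forall>e\<in>E. q e \<in> poly_ring ?U) \<and> p - (\<Sum>e\<in>E. q e * e) \<in> K"
      using ab by blast
  next
    fix p assume p: "p \<in> poly_ring ?U" "p \<in> K"
    show "p = 0"
    proof (rule extend_ideal_by_linear_form[OF Suc.prems(1) u Qi E])
      show "\<exists>q. (\<forall>e\<in>E. q e \<in> poly_ring U) \<and> p - (\<Sum>e\<in>E. q e * e) \<in> Q" if "p \<in> ?P" for p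
        using Suc.prems(3)[OF that] Q(2) by blast
      show "p = 0" if "p \<in> poly_ring U" "p \<in> Q" for p using that Q(3) by blast
    qed (use p in \<open>auto simp: K_def l_def\<close>)
  qed
  then obtain \<pp> :: "nat \<Rightarrow> ('a \<Rightarrow> real) set" where
    \<pp>: "\<forall>i\<le>dim ?U. prime_of ?P (\<pp> i)" "\<forall>i<dim ?U. \<pp> i \<subset> \<pp> (Suc i)" "K \<subseteq> \<pp> 0" by blast
  have d: "dim U = Suc (dim ?U)" using dim_orth_in[OF Suc.prems(1) u] Suc.hyps(2) by simp
  have "l \<noteq> 0"
  proof
    assume "l = 0"
    then have "u \<bullet> u = 0" unfolding l_def by (metis zero_fun_apply)
    then show False using u(2) by simp
  qed
  then have "l \<notin> Q" using lU Q(3) by blast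
  then have 0: "Q \<subset> \<pp> 0" using ext(2,3) \<pp>(3) by blast
  define \<qq> where "\<qq> = (\<lambda>i. case i of 0 \<Rightarrow> Q | Suc j \<Rightarrow> \<pp> j)"
  have "\<forall>i\<le>dim U. prime_of ?P (\<qq> i)"
    using Q(1) \<pp>(1) by (auto simp: \<qq>_def d split: nat.split)
  moreover have "\<forall>i<dim U. \<qq> i \<subset> \<qq> (Suc i)"
    using 0 \<pp>(2) by (auto simp: \<qq>_def d split: nat.split)
  moreover have "J \<subseteq> \<qq> 0" using Q(2) by (simp add: \<qq>_def)
  ultimately show ?case by blast
qed

section \<open>Noether normalization\<close>

text \<open>
  \<open>H\<close> is the homogeneous part of degree \<open>e\<close> of the polynomial \<open>F\<close>: it is homogeneous and
  depends only on the linear forms of \<open>U\<close>, the difference \<open>F - H\<close> has smaller degree, and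
  \<open>H u\<close> is the coefficient of the \<open>e\<close>-th power in \<open>F\<close> as a polynomial in the linear form of
  the unit vector \<open>u\<close>.
\<close>

definition leading_form ::
    "'a::euclidean_space set \<Rightarrow> nat \<Rightarrow> ('a \<Rightarrow> real) \<Rightarrow> ('a \<Rightarrow> real) \<Rightarrow> bool" where
  "leading_form U e F H \<longleftrightarrow>
    (\<forall>s x. H (s *\<^sub>R x) = s ^ e * H x) \<and>
    (\<forall>x z. (\<forall>v\<in>U. v \<bullet> z = 0) \<longrightarrow> H (x + z) = H x) \<and>
    (\<exists>G. (\<forall>x. F x = H x + G x) \<and> (if e = 0 then G = (\<lambda>x. 0) else poly_deg U (e - 1) G)) \<and>
    (\<forall>u\<in>U. norm u = 1 \<longrightarrow> (\<exists>f. (\<forall>j<e. poly_deg (orth_in U u) (e - j) (f j)) \<and>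
       (\<forall>x. F x = H u * (u \<bullet> x) ^ e + (\<Sum>j<e. f j x * (u \<bullet> x) ^ j))))"

lemma leading_formI:
  assumes "\<And>s x. H (s *\<^sub>R x) = s ^ e * H x"
    and "\<And>x z. \<forall>v\<in>U. v \<bullet> z = 0 \<Longrightarrow> H (x + z) = H x"
    and "\<And>x. F x = H x + G x" "if e = 0 then G = (\<lambda>x. 0) else poly_deg U (e - 1) G"
    and "\<And>u. u \<in> U \<Longrightarrow> norm u = 1 \<Longrightarrow> \<exists>f. (\<forall>j<e. poly_deg (orth_in U u) (e - j) (f j)) \<and>
       (\<forall>x. F x = H u * (u \<bullet> x) ^ e + (\<Sum>j<e. f j x * (u \<bullet> x) ^ j))"
  shows "leading_form U e F H"
  unfolding leading_form_def
proof (intro conjI)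
  show "\<exists>G. (\<forall>x. F x = H x + G x) \<and> (if e = 0 then G = (\<lambda>x. 0) else poly_deg U (e - 1) G)"
    using assms(3,4) by (intro exI[of _ G] conjI allI)
qed (use assms(1,2,5) in simp_all)

lemma leading_formD:
  assumes "leading_form U e F H"
  shows "\<And>s x. H (s *\<^sub>R x) = s ^ e * H x"
    and "\<And>x z. \<forall>v\<in>U. v \<bullet> z = 0 \<Longrightarrow> H (x + z) = H x"
    and "\<exists>G. (\<forall>x. F x = H x + G x) \<and> (if e = 0 then G = (\<lambda>x. 0) else poly_deg U (e - 1) G)"
    and "\<And>u. u \<in> U \<Longrightarrow> norm u = 1 \<Longrightarrow> \<exists>f. (\<forall>j<e. poly_deg (orth_in U u) (e - j) (f j)) \<and>
       (\<forall>x. F x = H u * (u \<bullet> x) ^ e + (\<Sum>j<e. f j x * (u \<bullet> x) ^ j))"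
  using assms unfolding leading_form_def by simp_all

lemma sum_only_constant_term:
  fixes t :: "'x \<Rightarrow> real"
  assumes "0 < e"
  shows "(\<Sum>j<e. (if j = 0 then (\<lambda>x. c) else (\<lambda>x. 0)) x * t x ^ j) = c"
proof -
  have "(\<Sum>j<e. (if j = 0 then (\<lambda>x. c) else (\<lambda>x. 0)) x * t x ^ j) = (\<Sum>j<e. if j = 0 then c else 0)"
    by (rule sum.cong) auto
  then show ?thesis using assms by simp
qed

lemma leading_form_exists:
  fixes F :: "'a::euclidean_space \<Rightarrow> real"
  assumes "poly_deg U e F" "subspace U"
  shows "\<exists>H. leading_form U e F H"
  using assms
proof (induction rule: poly_deg.induct)
  case (const m c)
  show ?case
  proof (cases "m = 0")
    case True
    have "leading_form U 0 (\<lambda>x. c) (\<lambda>x. c)"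
      by (rule leading_formI[where G = "\<lambda>x. 0"]) auto
    then show ?thesis using True by blast
  next
    case False
    define f :: "nat \<Rightarrow> 'a \<Rightarrow> real" where "f = (\<lambda>j. if j = 0 then (\<lambda>x. c) else (\<lambda>x. 0))"
    have "leading_form U m (\<lambda>x. c) (\<lambda>x. 0)"
    proof (rule leading_formI[where G = "\<lambda>x. c"])
      fix u :: 'a
      have "poly_deg (orth_in U u) (m - j) (f j)" for j
        by (auto simp: f_def intro: poly_deg.const)
      moreover have "c = 0 * (u \<bullet> x) ^ m + (\<Sum>j<m. f j x * (u \<bullet> x) ^ j)" for x
        unfolding f_def using sum_only_constant_term[of m c x "(\<bullet>) u"] False by simp
      ultimately show "\<exists>f. (\<forall>j<m. poly_deg (orth_in U u) (m - j) (f j)) \<and>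
          (\<forall>x. c = 0 * (u \<bullet> x) ^ m + (\<Sum>j<m. f j x * (u \<bullet> x) ^ j))" by (intro exI[of _ f]) simp
    qed (use False in \<open>auto intro: poly_deg.const\<close>)
    then show ?thesis by blast
  qed
next
  case (add m p q)
  then obtain H1 H2 where H1: "leading_form U m p H1" and H2: "leading_form U m q H2" by blast
  obtain G1 where G1: "\<And>x. p x = H1 x + G1 x" "if m = 0 then G1 = (\<lambda>x. 0) else poly_deg U (m - 1) G1"
    using leading_formD(3)[OF H1] by auto
  obtain G2 where G2: "\<And>x. q x = H2 x + G2 x" "if m = 0 then G2 = (\<lambda>x. 0) else poly_deg U (m - 1) G2"
    using leading_formD(3)[OF H2] by auto
  have "leading_form U m (\<lambda>x. p x + q x) (\<lambda>x. H1 x + H2 x)"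
  proof (rule leading_formI[where G = "\<lambda>x. G1 x + G2 x"])
    show "H1 (s *\<^sub>R x) + H2 (s *\<^sub>R x) = s ^ m * (H1 x + H2 x)" for s x
      by (simp add: leading_formD(1)[OF H1] leading_formD(1)[OF H2] distrib_left)
    show "H1 (x + z) + H2 (x + z) = H1 x + H2 x" if "\<forall>v\<in>U. v \<bullet> z = 0" for x z
      by (simp add: leading_formD(2)[OF H1 that] leading_formD(2)[OF H2 that])
    show "p x + q x = H1 x + H2 x + (G1 x + G2 x)" for x by (simp add: G1(1) G2(1))
    show "if m = 0 then (\<lambda>x. G1 x + G2 x) = (\<lambda>x. 0) else poly_deg U (m - 1) (\<lambda>x. G1 x + G2 x)"
      using G1(2) G2(2) by (auto intro: poly_deg.add)
    fix u assume u: "u \<in> U" "norm u = 1"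
    obtain f where f: "\<And>j. j < m \<Longrightarrow> poly_deg (orth_in U u) (m - j) (f j)"
      "\<And>x. p x = H1 u * (u \<bullet> x) ^ m + (\<Sum>j<m. f j x * (u \<bullet> x) ^ j)"
      using leading_formD(4)[OF H1 u] by auto
    obtain g where g: "\<And>j. j < m \<Longrightarrow> poly_deg (orth_in U u) (m - j) (g j)"
      "\<And>x. q x = H2 u * (u \<bullet> x) ^ m + (\<Sum>j<m. g j x * (u \<bullet> x) ^ j)"
      using leading_formD(4)[OF H2 u] by auto
    show "\<exists>f. (\<forall>j<m. poly_deg (orth_in U u) (m - j) (f j)) \<and>
        (\<forall>x. p x + q x = (H1 u + H2 u) * (u \<bullet> x) ^ m + (\<Sum>j<m. f j x * (u \<bullet> x) ^ j))"
      by (intro exI[of _ "\<lambda>j x. f j x + g j x"] conjI allI impI poly_deg.add f(1) g(1))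
        (simp_all add: f(2) g(2) distrib_right sum.distrib)
  qed
  then show ?case by blast
next
  case (lin m p v)
  then obtain H where H: "leading_form U m p H" by blast
  obtain G where G: "\<And>x. p x = H x + G x" "if m = 0 then G = (\<lambda>x. 0) else poly_deg U (m - 1) G"
    using leading_formD(3)[OF H] by auto
  have "leading_form U (Suc m) (\<lambda>x. (v \<bullet> x) * p x) (\<lambda>x. (v \<bullet> x) * H x)"
  proof (rule leading_formI[where G = "\<lambda>x. (v \<bullet> x) * G x"])
    show "v \<bullet> (s *\<^sub>R x) * H (s *\<^sub>R x) = s ^ Suc m * (v \<bullet> x * H x)" for s x
      by (simp add: leading_formD(1)[OF H])
    show "v \<bullet> (x + z) * H (x + z) = v \<bullet> x * H x" if "\<forall>v\<in>U. v \<bullet> z = 0" for x z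
      using that lin.hyps(2) by (simp add: leading_formD(2)[OF H that] inner_add_right)
    show "v \<bullet> x * p x = v \<bullet> x * H x + v \<bullet> x * G x" for x by (simp add: G(1) distrib_left)
    show "if Suc m = 0 then (\<lambda>x. v \<bullet> x * G x) = (\<lambda>x. 0) else poly_deg U (Suc m - 1) (\<lambda>x. v \<bullet> x * G x)"
    proof (cases m)
      case 0
      then show ?thesis using G(2) by (auto intro: poly_deg.const)
    next
      case (Suc k)
      then show ?thesis using G(2) poly_deg.lin[OF _ lin.hyps(2), of k G] by simp
    qed
    fix u assume u: "u \<in> U" "norm u = 1"
    obtain f where f: "\<And>j. j < m \<Longrightarrow> poly_deg (orth_in U u) (m - j) (f j)"
      "\<And>x. p x = H u * (u \<bullet> x) ^ m + (\<Sum>j<m. f j x * (u \<bullet> x) ^ j)"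
      using leading_formD(4)[OF H u] by auto
    define w where "w = v - (u \<bullet> v) *\<^sub>R u"
    have w: "w \<in> orth_in U u"
      unfolding w_def by (rule orth_in_part[OF lin.prems u lin.hyps(2)])
    have vw: "v \<bullet> x = w \<bullet> x + (v \<bullet> u) * (u \<bullet> x)" for x
      by (simp add: w_def inner_diff_left inner_commute[of u v])
    define f1 where "f1 = (\<lambda>j. if j < m then f j else (\<lambda>x. H u))"
    define f2 where "f2 = (\<lambda>j. if j = 0 then (\<lambda>x. 0) else f (j - 1))"
    define g where "g = (\<lambda>j x. (w \<bullet> x) * f1 j x + (v \<bullet> u) * f2 j x)"
    have g_deg: "poly_deg (orth_in U u) (Suc m - j) (g j)" if "j < Suc m" for j
    proof -
      have f1: "poly_deg (orth_in U u) (m - j) (f1 j)"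
        using f(1) by (auto simp: f1_def intro: poly_deg.const)
      have "Suc m - j = Suc (m - j)" using that by simp
      then have "poly_deg (orth_in U u) (Suc m - j) (\<lambda>x. (w \<bullet> x) * f1 j x)"
        using poly_deg.lin[OF f1 w] by simp
      moreover have "poly_deg (orth_in U u) (Suc m - j) (f2 j)"
      proof (cases j)
        case 0
        then show ?thesis by (simp add: f2_def poly_deg.const)
      next
        case (Suc i)
        then show ?thesis using f(1)[of i] that by (simp add: f2_def)
      qed
      ultimately show ?thesis unfolding g_def by (intro poly_deg.add poly_deg_cmult)
    qed
    have g_sum: "(v \<bullet> x) * p x = ((v \<bullet> u) * H u) * (u \<bullet> x) ^ Suc m + (\<Sum>j<Suc m. g j x * (u \<bullet> x) ^ j)"
      for x
    proof -
      have s1: "(\<Sum>j<Suc m. f1 j x * (u \<bullet> x) ^ j) = p x"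
        by (simp add: f(2) f1_def)
      have "(\<Sum>j<Suc m. f2 j x * (u \<bullet> x) ^ j) = (\<Sum>j<m. f j x * (u \<bullet> x) ^ Suc j)"
        unfolding sum.lessThan_Suc_shift by (simp add: f2_def)
      also have "\<dots> = (u \<bullet> x) * (\<Sum>j<m. f j x * (u \<bullet> x) ^ j)"
        unfolding sum_distrib_left by (rule sum.cong) simp_all
      also have "\<dots> = (u \<bullet> x) * (p x - H u * (u \<bullet> x) ^ m)"
        by (simp add: f(2))
      finally have s2: "(\<Sum>j<Suc m. f2 j x * (u \<bullet> x) ^ j) = (u \<bullet> x) * (p x - H u * (u \<bullet> x) ^ m)" .
      have "(\<Sum>j<Suc m. g j x * (u \<bullet> x) ^ j)
          = (w \<bullet> x) * (\<Sum>j<Suc m. f1 j x * (u \<bullet> x) ^ j) + (v \<bullet> u) * (\<Sum>j<Suc m. f2 j x * (u \<bullet> x) ^ j)"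
        unfolding g_def by (simp only: distrib_right sum.distrib sum_distrib_left mult.assoc)
      then show ?thesis unfolding s1 s2 vw[of x] by (simp add: algebra_simps)
    qed
    show "\<exists>f. (\<forall>j<Suc m. poly_deg (orth_in U u) (Suc m - j) (f j)) \<and>
        (\<forall>x. v \<bullet> x * p x = v \<bullet> u * H u * (u \<bullet> x) ^ Suc m + (\<Sum>j<Suc m. f j x * (u \<bullet> x) ^ j))"
      by (intro exI[of _ g] conjI allI impI g_deg g_sum)
  qed
  then show ?case by blast
qed

text \<open>Division with remainder by a relation that is monic in the linear form \<open>u\<close>, on a set \<open>X\<close>.\<close>

lemma poly_deg_divide:
  fixes U :: "'a::euclidean_space set"
  assumes U: "subspace U" "u \<in> U" "norm u = 1" and "0 < e"
    and g: "\<And>j. j < e \<Longrightarrow> poly_deg (orth_in U u) (e - j) (g j)"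
    and rel: "\<And>x. x \<in> X \<Longrightarrow> (u \<bullet> x) ^ e = (\<Sum>j<e. g j x * (u \<bullet> x) ^ j)"
    and q: "poly_deg U m q"
  shows "\<exists>r. (\<forall>j<e. poly_deg (orth_in U u) m (r j)) \<and>
    (\<forall>x\<in>X. q x = (\<Sum>j<e. r j x * (u \<bullet> x) ^ j))"
proof -
  let ?U = "orth_in U u"
  \<comment> \<open>The coefficient of the \<open>j\<close>-th power has degree at most \<open>m - j\<close>, and is zero if \<open>j > m\<close>.\<close>
  define D where "D = (\<lambda>j m p. (j \<le> m \<and> poly_deg ?U (m - j) p) \<or> p = (\<lambda>x. 0))"
  have D_add: "D j m (\<lambda>x. a x + b x)" if "D j m a" "D j m b" for j m a b
    using that by (auto simp: D_def intro: poly_deg.add)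
  have D_cmult: "D j m (\<lambda>x. c * a x)" if "D j m a" for j m a c
    using that by (auto simp: D_def intro: poly_deg_cmult)
  have D_0: "D j m (\<lambda>x. 0)" for j m by (auto simp: D_def)
  have "\<exists>r. (\<forall>j<e. D j m (r j)) \<and> (\<forall>x\<in>X. q x = (\<Sum>j<e. r j x * (u \<bullet> x) ^ j))"
    using q
  proof (induction rule: poly_deg.induct)
    case (const m c)
    define r :: "nat \<Rightarrow> 'a \<Rightarrow> real" where "r = (\<lambda>j. if j = 0 then (\<lambda>x. c) else (\<lambda>x. 0))"
    have "D j m (r j)" for j by (auto simp: D_def r_def intro: poly_deg.const)
    moreover have "c = (\<Sum>j<e. r j x * (u \<bullet> x) ^ j)" for x
      unfolding r_def using sum_only_constant_term[OF \<open>0 < e\<close>, of c x "(\<bullet>) u"] by simp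
    ultimately show ?case by (intro exI[of _ r]) simp
  next
    case (add m p q)
    obtain r where r: "\<And>j. j < e \<Longrightarrow> D j m (r j)" "\<And>x. x \<in> X \<Longrightarrow> p x = (\<Sum>j<e. r j x * (u \<bullet> x) ^ j)"
      using add.IH(1) by auto
    obtain s where s: "\<And>j. j < e \<Longrightarrow> D j m (s j)" "\<And>x. x \<in> X \<Longrightarrow> q x = (\<Sum>j<e. s j x * (u \<bullet> x) ^ j)"
      using add.IH(2) by auto
    show ?case
      by (intro exI[of _ "\<lambda>j x. r j x + s j x"] conjI allI impI ballI D_add r(1) s(1))
        (simp_all add: r(2) s(2) distrib_right sum.distrib)
  next
    case (lin m p v)
    obtain r where r: "\<And>j. j < e \<Longrightarrow> D j m (r j)"
      "\<And>x. x \<in> X \<Longrightarrow> p x = (\<Sum>j<e. r j x * (u \<bullet> x) ^ j)" using lin.IH by auto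
    define w where "w = v - (u \<bullet> v) *\<^sub>R u"
    have w: "w \<in> ?U" unfolding w_def by (rule orth_in_part[OF U lin.hyps(2)])
    have vw: "v \<bullet> x = w \<bullet> x + (u \<bullet> v) * (u \<bullet> x)" for x
      by (simp add: w_def inner_diff_left)
    obtain d where d: "e = Suc d" using \<open>0 < e\<close> by (cases e) auto
    define r' where "r' = (\<lambda>j. if j = 0 then (\<lambda>x. 0) else r (j - 1))"
    define s where "s = (\<lambda>j x. (w \<bullet> x) * r j x + (u \<bullet> v) * (r' j x + r d x * g j x))"
    have "D j (Suc m) (s j)" if j: "j < e" for j
      unfolding s_def
    proof (intro D_add D_cmult)
      show "D j (Suc m) (\<lambda>x. (w \<bullet> x) * r j x)"
        using r(1)[OF j] poly_deg.lin[OF _ w, of "m - j" "r j"] by (auto simp: D_def Suc_diff_le)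
      show "D j (Suc m) (r' j)"
        using r(1)[of "j - 1"] j by (cases j) (auto simp: D_def r'_def)
      show "D j (Suc m) (\<lambda>x. r d x * g j x)"
      proof (cases "r d = (\<lambda>x. 0)")
        case False
        then have *: "d \<le> m" "poly_deg ?U (m - d) (r d)" using r(1)[of d] d by (auto simp: D_def)
        have "poly_deg ?U ((m - d) + (e - j)) (\<lambda>x. r d x * g j x)"
          by (rule poly_deg_mult[OF *(2) g[OF j]])
        moreover have "(m - d) + (e - j) = Suc m - j" using d *(1) j by simp
        ultimately show ?thesis using j d *(1) by (auto simp: D_def)
      qed (simp add: D_0)
    qed
    moreover have "(v \<bullet> x) * p x = (\<Sum>j<e. s j x * (u \<bullet> x) ^ j)" if x: "x \<in> X" for x
    proof -
      have "(\<Sum>j<e. s j x * (u \<bullet> x) ^ j) = (w \<bullet> x) * (\<Sum>j<e. r j x * (u \<bullet> x) ^ j)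
          + (u \<bullet> v) * ((\<Sum>j<e. r' j x * (u \<bullet> x) ^ j) + r d x * (\<Sum>j<e. g j x * (u \<bullet> x) ^ j))"
        by (simp add: s_def sum_distrib_left distrib_right distrib_left sum.distrib mult.assoc)
      also have "(\<Sum>j<e. r' j x * (u \<bullet> x) ^ j) = (\<Sum>j<d. r j x * (u \<bullet> x) ^ Suc j)"
        unfolding d by (simp add: sum.lessThan_Suc_shift r'_def del: sum.lessThan_Suc)
      also have "(\<Sum>j<d. r j x * (u \<bullet> x) ^ Suc j) + r d x * (\<Sum>j<e. g j x * (u \<bullet> x) ^ j)
          = (\<Sum>j<e. r j x * (u \<bullet> x) ^ Suc j)"
        unfolding rel[OF x, symmetric] by (simp add: d)
      also have "\<dots> = (u \<bullet> x) * (\<Sum>j<e. r j x * (u \<bullet> x) ^ j)"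
        by (simp add: sum_distrib_left mult_ac)
      finally show ?thesis by (simp add: r(2)[OF x, symmetric] vw[of x] algebra_simps)
    qed
    ultimately show ?case by blast
  qed
  then obtain r where r: "\<forall>j<e. D j m (r j)" "\<forall>x\<in>X. q x = (\<Sum>j<e. r j x * (u \<bullet> x) ^ j)" by blast
  have "poly_deg ?U m (r j)" if "j < e" for j
    using r(1) that poly_deg_mono[of ?U "m - j" "r j" m] unfolding D_def
    by (metis diff_le_self poly_deg.const)
  then show ?thesis using r(2) by blast
qed

text \<open>
  On \<open>X\<close>, every polynomial is a combination of the finitely many functions in \<open>E\<close> whose
  coefficients are polynomials of no larger degree in the linear forms of \<open>U\<close>.
\<close>

definition module_finite_on :: "'a::euclidean_space set \<Rightarrow> 'a set \<Rightarrow> ('a \<Rightarrow> real) set \<Rightarrow> bool" where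
  "module_finite_on X U E \<longleftrightarrow> finite E \<and> E \<subseteq> poly_ring UNIV \<and>
    (\<forall>m p. poly_deg UNIV m p \<longrightarrow>
      (\<exists>q. (\<forall>e\<in>E. poly_deg U m (q e)) \<and> (\<forall>x\<in>X. p x = (\<Sum>e\<in>E. q e x * e x))))"

lemma module_finite_onD:
  assumes "module_finite_on X U E" "poly_deg UNIV m p"
  shows "\<exists>q. (\<forall>e\<in>E. poly_deg U m (q e)) \<and> (\<forall>x\<in>X. p x = (\<Sum>e\<in>E. q e x * e x))"
  using assms unfolding module_finite_on_def by blast

lemma sum_regroup_image:
  fixes a :: "'i \<Rightarrow> 'x \<Rightarrow> real"
  assumes "finite I"
  shows "(\<Sum>i\<in>I. a i x * h i x) = (\<Sum>g\<in>h ` I. (\<Sum>i | i \<in> I \<and> h i = g. a i x) * g x)"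
proof -
  have "(\<Sum>i\<in>I. a i x * h i x) = (\<Sum>g\<in>h ` I. \<Sum>i | i \<in> I \<and> h i = g. a i x * h i x)"
    by (rule sum.image_gen[OF assms])
  also have "\<dots> = (\<Sum>g\<in>h ` I. (\<Sum>i | i \<in> I \<and> h i = g. a i x) * g x)"
    by (intro sum.cong refl) (auto simp: sum_distrib_right intro!: sum.cong)
  finally show ?thesis .
qed

text \<open>A relation on \<open>X\<close> that is monic in the linear form \<open>u\<close> eliminates this variable from \<open>U\<close>.\<close>

lemma module_finite_on_reduce:
  fixes U :: "'a::euclidean_space set"
  assumes U: "subspace U" "u \<in> U" "norm u = 1" and "0 < d"
    and g: "\<And>j. j < d \<Longrightarrow> poly_deg (orth_in U u) (d - j) (g j)"
    and rel: "\<And>x. x \<in> X \<Longrightarrow> (u \<bullet> x) ^ d = (\<Sum>j<d. g j x * (u \<bullet> x) ^ j)"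
    and E: "module_finite_on X U E"
  shows "module_finite_on X (orth_in U u) ((\<lambda>(e, j) x. e x * (u \<bullet> x) ^ j) ` (E \<times> {..<d}))"
proof -
  let ?h = "\<lambda>(e, j) x. e x * (u \<bullet> x) ^ j" and ?I = "E \<times> {..<d}" and ?U = "orth_in U u"
  have fin: "finite ?I" and EP: "E \<subseteq> poly_ring UNIV" using E by (auto simp: module_finite_on_def)
  have "?h ` ?I \<subseteq> poly_ring UNIV"
  proof
    fix h assume "h \<in> ?h ` ?I"
    then obtain e j where "h = (\<lambda>x. e x * (u \<bullet> x) ^ j)" "e \<in> E" by auto
    moreover obtain m where "poly_deg UNIV m e" using \<open>e \<in> E\<close> EP by (auto simp: poly_ring_def)
    ultimately show "h \<in> poly_ring UNIV"
      using poly_deg_mult[OF _ poly_deg_power[of u UNIV j]] by (auto simp: poly_ring_def)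
  qed
  moreover have "\<exists>q. (\<forall>e\<in>?h ` ?I. poly_deg ?U m (q e)) \<and> (\<forall>x\<in>X. p x = (\<Sum>e\<in>?h ` ?I. q e x * e x))"
    if p: "poly_deg UNIV m p" for m p
  proof -
    obtain q where q: "\<And>e. e \<in> E \<Longrightarrow> poly_deg U m (q e)" "\<And>x. x \<in> X \<Longrightarrow> p x = (\<Sum>e\<in>E. q e x * e x)"
      using module_finite_onD[OF E p] by blast
    have "\<forall>e\<in>E. \<exists>r. (\<forall>j<d. poly_deg ?U m (r j)) \<and>
        (\<forall>x\<in>X. q e x = (\<Sum>j<d. r j x * (u \<bullet> x) ^ j))"
      using poly_deg_divide[OF U \<open>0 < d\<close> g rel q(1)] by simp
    then have "\<exists>r. \<forall>e\<in>E. (\<forall>j<d. poly_deg ?U m (r e j)) \<and>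
        (\<forall>x\<in>X. q e x = (\<Sum>j<d. r e j x * (u \<bullet> x) ^ j))"
      by (rule bchoice)
    then obtain r where r: "\<And>e j. e \<in> E \<Longrightarrow> j < d \<Longrightarrow> poly_deg ?U m (r e j)"
      "\<And>e x. e \<in> E \<Longrightarrow> x \<in> X \<Longrightarrow> q e x = (\<Sum>j<d. r e j x * (u \<bullet> x) ^ j)" by auto
    define a where "a = (\<lambda>i. r (fst i) (snd i))"
    have "p x = (\<Sum>i\<in>?I. a i x * ?h i x)" if x: "x \<in> X" for x
    proof -
      have "p x = (\<Sum>e\<in>E. \<Sum>j<d. a (e, j) x * ?h (e, j) x)"
        unfolding q(2)[OF x]
        by (intro sum.cong refl) (auto simp: r(2)[OF _ x] sum_distrib_left a_def mult_ac)
      then show ?thesis by (simp add: sum.cartesian_product split_def)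
    qed
    then have "p x = (\<Sum>f\<in>?h ` ?I. (\<Sum>i | i \<in> ?I \<and> ?h i = f. a i x) * f x)" if "x \<in> X" for x
      using that sum_regroup_image[OF fin, of a x ?h] by simp
    moreover have "poly_deg ?U m (\<lambda>x. \<Sum>i | i \<in> ?I \<and> ?h i = f. a i x)" for f
      by (rule poly_deg_sum) (auto simp: a_def intro: r(1))
    ultimately show ?thesis
      by (intro exI[of _ "\<lambda>f x. \<Sum>i | i \<in> ?I \<and> ?h i = f. a i x"] conjI ballI)
  qed
  ultimately show ?thesis
    unfolding module_finite_on_def using fin by (intro conjI allI impI finite_imageI)
qed

text \<open>
  The subspace \<open>U\<close> is chosen of least dimension.  If a nonzero polynomial \<open>F\<close> in the linear forms
  of \<open>U\<close> vanished on \<open>X\<close>, then \<open>F\<close> would be monic, up to a constant, in some linear form of \<open>U\<close>,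
  and this variable could be eliminated.
\<close>

lemma noether_normalization:
  fixes X :: "'a::euclidean_space set"
  assumes "X \<noteq> {}"
  shows "\<exists>U E. subspace U \<and> module_finite_on X U E \<and>
    (\<forall>p\<in>poly_ring U. (\<forall>x\<in>X. p x = 0) \<longrightarrow> p = 0)"
proof -
  define Q where "Q = (\<lambda>n. \<exists>U E. subspace U \<and> module_finite_on X U E \<and> dim U = n)"
  have "module_finite_on X UNIV {1}"
  proof -
    have "1 \<in> poly_ring (UNIV :: 'a set)" using subring_ofD(1)[OF subring_of_poly_ring] .
    moreover have "\<exists>q. (\<forall>e\<in>{1::'a \<Rightarrow> real}. poly_deg UNIV m (q e)) \<and> (\<forall>x\<in>X. p x = (\<Sum>e\<in>{1}. q e x * e x))"
      if "poly_deg UNIV m p" for m p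
      using that by (intro exI[of _ "\<lambda>_. p"]) simp
    ultimately show ?thesis
      unfolding module_finite_on_def by (intro conjI allI impI) (simp_all only: finite.intros empty_subsetI insert_subset)
  qed
  then have "Q (dim (UNIV :: 'a set))" unfolding Q_def using subspace_UNIV by blast
  then have "Q (LEAST n. Q n)" by (rule LeastI)
  then obtain U E where U: "subspace U" and E: "module_finite_on X U E" and dU: "dim U = (LEAST n. Q n)"
    unfolding Q_def by blast
  have "F = 0" if F: "F \<in> poly_ring U" "\<forall>x\<in>X. F x = 0" for F
  proof (rule ccontr)
    assume "F \<noteq> 0"
    define e where "e = (LEAST e. poly_deg U e F)"
    have e: "poly_deg U e F" unfolding e_def using F(1) by (auto simp: poly_ring_def intro: LeastI)
    obtain H where lead: "leading_form U e F H" using leading_form_exists[OF e U] by blast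
    note H = leading_formD(1,2)[OF lead]
    obtain G where G: "\<And>x. F x = H x + G x" "if e = 0 then G = (\<lambda>x. 0) else poly_deg U (e - 1) G"
      using leading_formD(3)[OF lead] by auto
    have "\<exists>x. H x \<noteq> 0"
    proof (rule ccontr)
      assume "\<nexists>x. H x \<noteq> 0"
      then have FG: "F = G" using G(1) by auto
      show False
      proof (cases "e = 0")
        case True
        then show ?thesis using FG G(2) \<open>F \<noteq> 0\<close> by (auto simp: zero_fun_def)
      next
        case False
        then have "poly_deg U (e - 1) F" using FG G(2) by simp
        then have "e \<le> e - 1" unfolding e_def by (rule Least_le)
        then show ?thesis using False by simp
      qed
    qed
    then obtain x where x: "H x \<noteq> 0" by blast
    have "e \<noteq> 0"
    proof
      assume 0: "e = 0"
      obtain a where "a \<in> X" using assms by blast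
      then have "H a = 0" using F(2) G 0 by auto
      moreover have "H y = H 0" for y using H(1)[of 0 y] 0 by simp
      ultimately show False using x by metis
    qed
    obtain y z where yz: "y \<in> span U" "\<And>w. w \<in> span U \<Longrightarrow> orthogonal z w" "x = y + z"
      using orthogonal_subspace_decomp_exists[of U x] by metis
    have "y \<in> U" using yz(1) U by (metis span_eq_iff)
    have "\<forall>v\<in>U. v \<bullet> z = 0"
      using yz(2) by (auto simp: orthogonal_def inner_commute intro: span_base)
    then have "H y \<noteq> 0" using H(2)[of z y] yz(3) x by simp
    have "H 0 = 0" using H(1)[of 0 x] \<open>e \<noteq> 0\<close> by simp
    then have "y \<noteq> 0" using \<open>H y \<noteq> 0\<close> by auto
    define u where "u = (1 / norm y) *\<^sub>R y"
    have u: "u \<in> U" "norm u = 1" using \<open>y \<in> U\<close> U \<open>y \<noteq> 0\<close> by (auto simp: u_def subspace_scale)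
    have c: "H u \<noteq> 0" using \<open>H y \<noteq> 0\<close> \<open>y \<noteq> 0\<close> unfolding u_def H(1) by simp
    obtain f where f: "\<And>j. j < e \<Longrightarrow> poly_deg (orth_in U u) (e - j) (f j)"
      "\<And>x. F x = H u * (u \<bullet> x) ^ e + (\<Sum>j<e. f j x * (u \<bullet> x) ^ j)"
      using leading_formD(4)[OF lead u] by auto
    define g where "g = (\<lambda>j x. (- 1 / H u) * f j x)"
    have "(u \<bullet> x) ^ e = (\<Sum>j<e. g j x * (u \<bullet> x) ^ j)" if "x \<in> X" for x
    proof -
      have "H u * (u \<bullet> x) ^ e = - (\<Sum>j<e. f j x * (u \<bullet> x) ^ j)"
        using F(2) that f(2)[of x] by simp
      then have "(u \<bullet> x) ^ e = (- 1 / H u) * (\<Sum>j<e. f j x * (u \<bullet> x) ^ j)"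
        using c by (simp add: field_simps)
      then show ?thesis by (simp add: g_def sum_distrib_left mult.assoc)
    qed
    moreover have "poly_deg (orth_in U u) (e - j) (g j)" if "j < e" for j
      unfolding g_def by (intro poly_deg_cmult f(1) that)
    ultimately have "module_finite_on X (orth_in U u) ((\<lambda>(f, j) x. f x * (u \<bullet> x) ^ j) ` (E \<times> {..<e}))"
      using module_finite_on_reduce[OF U u _ _ _ E, of e g] \<open>e \<noteq> 0\<close> by simp
    then have "Q (dim (orth_in U u))"
      unfolding Q_def using subspace_orth_in[OF U] by (intro exI[of _ "orth_in U u"] exI conjI refl)
    then have "dim U \<le> dim (orth_in U u)" unfolding dU by (rule Least_le)
    moreover have "dim U \<noteq> 0"
    proof
      assume "dim U = 0"
      then have "U \<subseteq> {0}" by simp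
      then show False using u by auto
    qed
    ultimately show False using dim_orth_in[OF U u] by linarith
  qed
  then show ?thesis using U E by (intro exI[of _ U] exI[of _ E] conjI ballI impI)
qed

section \<open>The Krull dimension bounds the growth of polynomials on a set\<close>

lemma carrier_polynomial_function_ring:
  "carrier polynomial_function_ring = poly_ring UNIV"
  by (simp add: polynomial_function_ring_def poly_ring_UNIV)

lemma ideal_of_imp_ideal:
  fixes J :: "('a::euclidean_space \<Rightarrow> real) set"
  assumes "ideal_of (poly_ring UNIV) J"
  shows "ideal J polynomial_function_ring"
proof -
  interpret cring "polynomial_function_ring :: ('a \<Rightarrow> real) ring"
    by (rule cring_polynomial_function_ring)
  note Jd = ideal_ofD[OF assms] and P = subring_of_poly_ring[of "UNIV :: 'a set"]
  have neg: "\<ominus>\<^bsub>polynomial_function_ring\<^esub> p = - p" if "p \<in> poly_ring UNIV" for p :: "'a \<Rightarrow> real"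
    by (rule minus_equality)
      (use that subring_ofD(5)[OF P] in \<open>auto simp: carrier_polynomial_function_ring,
        auto simp: polynomial_function_ring_def\<close>)
  have "subgroup J (add_monoid polynomial_function_ring)"
  proof (rule add.subgroupI)
    show "J \<subseteq> carrier polynomial_function_ring"
      using Jd(1) by (auto simp: carrier_polynomial_function_ring)
    show "J \<noteq> {}" using Jd(2) by blast
    fix p q assume p: "p \<in> J"
    show "\<ominus>\<^bsub>polynomial_function_ring\<^esub> p \<in> J"
      using ideal_of_diff[OF P assms Jd(2) p] by (simp add: neg[OF Jd(1)[OF p]])
    assume q: "q \<in> J"
    show "p \<oplus>\<^bsub>polynomial_function_ring\<^esub> q \<in> J"
      using Jd(3)[OF p q] by (simp add: polynomial_function_ring_def plus_fun_def)
  qed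
  then show ?thesis
  proof (rule idealI[OF ring_axioms])
    fix a x assume a: "a \<in> J" and x: "x \<in> carrier (polynomial_function_ring :: ('a \<Rightarrow> real) ring)"
    have "x * a \<in> J" using Jd(4) a x by (simp add: carrier_polynomial_function_ring)
    then show "x \<otimes>\<^bsub>polynomial_function_ring\<^esub> a \<in> J" "a \<otimes>\<^bsub>polynomial_function_ring\<^esub> x \<in> J"
      by (simp_all add: polynomial_function_ring_def times_fun_def mult.commute)
  qed
qed

lemma prime_of_imp_primeideal_Quot:
  fixes J :: "('a::euclidean_space \<Rightarrow> real) set"
  assumes J: "prime_of (poly_ring UNIV) J" and I: "ideal I polynomial_function_ring" and "I \<subseteq> J"
  shows "primeideal ((+>\<^bsub>polynomial_function_ring\<^esub>) I ` J) (polynomial_function_ring Quot I)"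
proof -
  let ?R = "polynomial_function_ring :: ('a \<Rightarrow> real) ring"
  interpret cring ?R by (rule cring_polynomial_function_ring)
  interpret I: ideal I ?R by (rule I)
  have JI: "ideal J ?R" using J ideal_of_imp_ideal by (auto simp: prime_of_def)
  interpret J: ideal J ?R by (rule JI)
  let ?\<pi> = "(+>\<^bsub>?R\<^esub>) I"
  have inj: "inj_on (\<lambda>J. ?\<pi> ` J) {J. ideal J ?R \<and> I \<subseteq> J}"
    using quot_ideal_correspondence[OF I] by (rule bij_betw_imp_inj_on)
  have car: "carrier (?R Quot I) = ?\<pi> ` carrier ?R"
    by (auto simp: FactRing_def A_RCOSETS_def')
  have mem: "p \<in> J" if p: "p \<in> carrier ?R" "?\<pi> p \<in> ?\<pi> ` J" for p
  proof -
    have "p \<in> ?\<pi> p" by (rule I.a_rcos_self[OF p(1)])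
    then have "p \<in> (\<Union>j\<in>J. ?\<pi> j)" using p(2) by auto
    then show ?thesis using ideal_incl_iff[OF I JI] \<open>I \<subseteq> J\<close> by blast
  qed
  show ?thesis
  proof (rule primeidealI)
    show "ideal (?\<pi> ` J) (?R Quot I)"
      using ring_ideal_imp_quot_ideal[OF I JI] .
    show "cring (?R Quot I)" using I.quotient_is_cring[OF cring_axioms] .
    show "carrier (?R Quot I) \<noteq> ?\<pi> ` J"
    proof
      assume "carrier (?R Quot I) = ?\<pi> ` J"
      then have "?\<pi> \<one>\<^bsub>?R\<^esub> \<in> ?\<pi> ` J" unfolding car by blast
      then have "\<one>\<^bsub>?R\<^esub> \<in> J" by (intro mem) auto
      then show False using J by (auto simp: prime_of_def polynomial_function_ring_def one_fun_def)
    qed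
    fix a b assume "a \<in> carrier (?R Quot I)" "b \<in> carrier (?R Quot I)"
      and ab: "a \<otimes>\<^bsub>?R Quot I\<^esub> b \<in> ?\<pi> ` J"
    then obtain p q where pq: "p \<in> carrier ?R" "q \<in> carrier ?R" "a = ?\<pi> p" "b = ?\<pi> q"
      unfolding car by blast
    have "?\<pi> (p \<otimes>\<^bsub>?R\<^esub> q) \<in> ?\<pi> ` J"
      using ab I.rcoset_mult_add[OF pq(1,2)] by (simp add: pq(3,4) FactRing_def)
    then have "p \<otimes>\<^bsub>?R\<^esub> q \<in> J" using pq by (intro mem) auto
    then have "p * q \<in> J" by (simp add: polynomial_function_ring_def times_fun_def)
    then have "p \<in> J \<or> q \<in> J"
      using J pq(1,2) by (auto simp: prime_of_def carrier_polynomial_function_ring)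
    then show "a \<in> ?\<pi> ` J \<or> b \<in> ?\<pi> ` J" using pq by blast
  qed
qed

text \<open>The chain of primes over the vanishing ideal of \<open>X\<close> descends to the quotient ring.\<close>

lemma dim_le_semialgebraic_dim:
  fixes X :: "'a::euclidean_space set"
  assumes "subspace U" and E: "module_finite_on X U E"
    and inj: "\<And>p. p \<in> poly_ring U \<Longrightarrow> \<forall>x\<in>X. p x = 0 \<Longrightarrow> p = 0"
  shows "ereal (real (dim U)) \<le> semialgebraic_dim X"
proof -
  let ?R = "polynomial_function_ring :: ('a \<Rightarrow> real) ring" and ?I = "vanishing_ideal X"
  interpret cring ?R by (rule cring_polynomial_function_ring)
  note P = subring_of_poly_ring[of "UNIV :: 'a set"]
  have mem: "p \<in> ?I \<longleftrightarrow> p \<in> poly_ring UNIV \<and> (\<forall>x\<in>X. p x = 0)" for p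
    by (auto simp: vanishing_ideal_def poly_ring_UNIV)
  have I: "ideal_of (poly_ring UNIV) ?I"
    unfolding ideal_of_def using subring_ofD[OF P] by (auto simp: mem)
  have I': "ideal ?I ?R" by (rule ideal_vanishing_ideal)
  have E': "finite E" "E \<subseteq> poly_ring UNIV" using E by (auto simp: module_finite_on_def)
  have RP: "poly_ring U \<subseteq> poly_ring UNIV" by (rule poly_ring_mono) auto
  have fin: "\<exists>q. (\<forall>e\<in>E. q e \<in> poly_ring U) \<and> p - (\<Sum>e\<in>E. q e * e) \<in> ?I"
    if p: "p \<in> poly_ring UNIV" for p
  proof -
    obtain m where m: "poly_deg UNIV m p" using p by (auto simp: poly_ring_def)
    obtain q where q: "\<forall>e\<in>E. poly_deg U m (q e)" "\<forall>x\<in>X. p x = (\<Sum>e\<in>E. q e x * e x)"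
      using module_finite_onD[OF E m] by blast
    have qR: "\<forall>e\<in>E. q e \<in> poly_ring U" using q(1) by (auto simp: poly_ring_def)
    have sum_apply: "(\<Sum>e\<in>A. q e * e) x = (\<Sum>e\<in>A. q e x * e x)" for A x
      by (induction A rule: infinite_finite_induct) auto
    have "(\<Sum>e\<in>A. q e * e) \<in> poly_ring UNIV" if "A \<subseteq> E" for A
      using finite_subset[OF that E'(1)] that
    proof (induction A rule: finite_induct)
      case (insert e A)
      then have "q e * e \<in> poly_ring UNIV" using qR RP E'(2) by (intro subring_ofD(4)[OF P]) auto
      moreover have "(\<Sum>e\<in>A. q e * e) \<in> poly_ring UNIV" using insert by blast
      ultimately show ?case unfolding sum.insert[OF insert.hyps(1,2)] by (rule subring_ofD(6)[OF P])
    qed (simp add: subring_ofD(2)[OF P])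
    then have "p - (\<Sum>e\<in>E. q e * e) \<in> poly_ring UNIV" using p subring_ofD(3)[OF P] by blast
    moreover have "(p - (\<Sum>e\<in>E. q e * e)) x = 0" if "x \<in> X" for x
      using q(2) that by (simp add: sum_apply)
    ultimately have "p - (\<Sum>e\<in>E. q e * e) \<in> ?I" by (simp add: mem)
    then show ?thesis using qR by blast
  qed
  have "\<exists>\<pp> :: nat \<Rightarrow> ('a \<Rightarrow> real) set. (\<forall>i\<le>dim U. prime_of (poly_ring UNIV) (\<pp> i)) \<and>
    (\<forall>i<dim U. \<pp> i \<subset> \<pp> (Suc i)) \<and> ?I \<subseteq> \<pp> 0"
    using prime_chain_exists[OF assms(1) I E' fin] inj mem by blast
  then obtain \<pp> :: "nat \<Rightarrow> ('a \<Rightarrow> real) set" where \<pp>: "\<And>i. i \<le> dim U \<Longrightarrow> prime_of (poly_ring UNIV) (\<pp> i)"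
    "\<And>i. i < dim U \<Longrightarrow> \<pp> i \<subset> \<pp> (Suc i)" "?I \<subseteq> \<pp> 0" by blast
  have le: "?I \<subseteq> \<pp> i" if "i \<le> dim U" for i
    using that by (induction i) (use \<pp>(2,3) in \<open>auto dest!: Suc_le_lessD\<close>)
  have id: "ideal (\<pp> i) ?R" if "i \<le> dim U" for i
    using ideal_of_imp_ideal \<pp>(1)[OF that] by (auto simp: prime_of_def)
  define \<qq> where "\<qq> = (\<lambda>i. (+>\<^bsub>?R\<^esub>) ?I ` \<pp> i)"
  have inj: "inj_on (\<lambda>J. (+>\<^bsub>?R\<^esub>) ?I ` J) {J. ideal J ?R \<and> ?I \<subseteq> J}"
    using quot_ideal_correspondence[OF I'] by (rule bij_betw_imp_inj_on)
  have "primeideal (\<qq> i) (?R Quot ?I)" if "i \<le> dim U" for i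
    unfolding \<qq>_def by (rule prime_of_imp_primeideal_Quot[OF \<pp>(1)[OF that] I' le[OF that]])
  moreover have "\<qq> i \<subset> \<qq> (Suc i)" if "i < dim U" for i
  proof -
    have "\<qq> i \<noteq> \<qq> (Suc i)"
    proof
      assume "\<qq> i = \<qq> (Suc i)"
      then have "\<pp> i = \<pp> (Suc i)"
        unfolding \<qq>_def by (rule inj_onD[OF inj]) (use that id le in auto)
      then show False using \<pp>(2)[OF that] by blast
    qed
    then show ?thesis using \<pp>(2)[OF that] unfolding \<qq>_def by blast
  qed
  ultimately show ?thesis
    unfolding semialgebraic_dim_def krull_dim_def by (intro Sup_upper) blast
qed

text \<open>
  A set has growth at most \<open>k\<close> if the restrictions to it of the polynomials of degree at
  most \<open>m\<close> lie in the span of \<open>O(m ^ k)\<close> functions.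
\<close>

definition poly_growth :: "'a::euclidean_space set \<Rightarrow> nat \<Rightarrow> bool" where
  "poly_growth X k \<longleftrightarrow> (\<exists>C. \<forall>m. \<exists>G. finite G \<and> card G \<le> C * (m + 1) ^ k \<and>
     (\<forall>p. poly_deg UNIV m p \<longrightarrow> (\<exists>c. \<forall>x\<in>X. p x = (\<Sum>g\<in>G. c g * g x))))"

lemma poly_deg_spanned:
  fixes U :: "'a::euclidean_space set"
  assumes "subspace U"
  shows "\<exists>G. finite G \<and> card G \<le> (m + 1) ^ dim U \<and>
    (\<forall>p. poly_deg U m p \<longrightarrow> (\<exists>c. \<forall>x. p x = (\<Sum>g\<in>G. c g * g x)))"
  using assms
proof (induction "dim U" arbitrary: U)
  case 0
  then have U: "U \<subseteq> {0}" by simp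
  have "p x = p 0 * 1" if p: "poly_deg U m p" for p x
  proof -
    have "v \<bullet> x = 0" if "v \<in> U" for v using U that by auto
    then show ?thesis using poly_deg_orthogonal_invariant[OF p, of x 0] by simp
  qed
  then have "\<exists>c. \<forall>x. p x = (\<Sum>g\<in>{\<lambda>x. 1}. c g * g x)" if "poly_deg U m p" for p
    using that by (intro exI[of _ "\<lambda>_. p 0"]) simp
  then show ?case by (intro exI[of _ "{\<lambda>x. 1}"]) auto
next
  case (Suc d)
  obtain B where "B \<subseteq> U" "\<And>x. x \<in> B \<Longrightarrow> norm x = 1" "card B = dim U"
    using orthonormal_basis_subspace[OF Suc.prems(1)] by metis
  then obtain u where u: "u \<in> U" "norm u = 1"
    using Suc.hyps(2) by (metis card.empty equals0I nat.distinct(1) subsetD)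
  let ?U = "orth_in U u"
  have d: "d = dim ?U" using dim_orth_in[OF Suc.prems(1) u] Suc.hyps(2) by simp
  obtain G where G: "finite G" "card G \<le> (m + 1) ^ d"
    "\<And>p. poly_deg ?U m p \<Longrightarrow> \<exists>c. \<forall>x. p x = (\<Sum>g\<in>G. c g * g x)"
    using Suc.hyps(1)[OF d subspace_orth_in[OF Suc.prems]] d by auto
  let ?h = "\<lambda>(g, j) x. g x * (u \<bullet> x) ^ j" and ?I = "G \<times> {..m}"
  have "card (?h ` ?I) \<le> card ?I" by (rule card_image_le) (use G(1) in auto)
  also have "\<dots> \<le> (m + 1) ^ d * (m + 1)" unfolding card_cartesian_product by (rule mult_mono) (use G(2) in auto)
  also have "\<dots> = (m + 1) ^ dim U" using Suc.hyps(2)[symmetric] by simp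
  finally have "card (?h ` ?I) \<le> (m + 1) ^ dim U" .
  moreover have "\<exists>c. \<forall>x. p x = (\<Sum>g\<in>?h ` ?I. c g * g x)" if p: "poly_deg U m p" for p
  proof -
    obtain H where H: "leading_form U m p H" using leading_form_exists[OF p Suc.prems] by blast
    obtain f where f: "\<And>j. j < m \<Longrightarrow> poly_deg ?U (m - j) (f j)"
      "\<And>x. p x = H u * (u \<bullet> x) ^ m + (\<Sum>j<m. f j x * (u \<bullet> x) ^ j)"
      using leading_formD(4)[OF H u] by auto
    define f' where "f' = (\<lambda>j. if j < m then f j else (\<lambda>x. H u))"
    have pf: "p x = (\<Sum>j\<le>m. f' j x * (u \<bullet> x) ^ j)" for x
    proof -
      have "p x = (\<Sum>j<Suc m. f' j x * (u \<bullet> x) ^ j)" by (simp add: f(2) f'_def)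
      then show ?thesis by (simp only: lessThan_Suc_atMost)
    qed
    have "poly_deg ?U m (f' j)" for j
      by (auto simp: f'_def intro: poly_deg.const poly_deg_mono[OF f(1)])
    then have "\<forall>j. \<exists>c. \<forall>x. f' j x = (\<Sum>g\<in>G. c g * g x)" by (intro allI G(3))
    then have "\<exists>c. \<forall>j x. f' j x = (\<Sum>g\<in>G. c j g * g x)" by (rule choice)
    then obtain c where c: "\<And>j x. f' j x = (\<Sum>g\<in>G. c j g * g x)" by auto
    define a where "a = (\<lambda>i (x::'a). c (snd i) (fst i))"
    have "p x = (\<Sum>i\<in>?I. a i x * ?h i x)" for x
    proof -
      have "p x = (\<Sum>j\<le>m. \<Sum>g\<in>G. a (g, j) x * ?h (g, j) x)"
        unfolding pf
      proof (intro sum.cong refl)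
        fix j
        show "f' j x * (u \<bullet> x) ^ j = (\<Sum>g\<in>G. a (g, j) x * ?h (g, j) x)"
          by (simp add: c a_def sum_distrib_left mult_ac)
      qed
      also have "\<dots> = (\<Sum>g\<in>G. \<Sum>j\<le>m. a (g, j) x * ?h (g, j) x)" by (rule sum.swap)
      finally show ?thesis by (simp add: sum.cartesian_product split_def)
    qed
    moreover define b where "b = (\<lambda>g. \<Sum>i | i \<in> ?I \<and> ?h i = g. c (snd i) (fst i))"
    ultimately have "p x = (\<Sum>g\<in>?h ` ?I. b g * g x)" for x
      using sum_regroup_image[of ?I a x ?h] G(1) by (simp add: a_def)
    then show ?thesis by blast
  qed
  moreover have "finite (?h ` ?I)" using G(1) by auto
  ultimately show ?case by blast
qed

lemma poly_growth_of_semialgebraic_dim: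
  fixes X :: "'a::euclidean_space set"
  assumes "semialgebraic_dim X \<le> ereal (real k)"
  shows "poly_growth X k"
proof (cases "X = {}")
  case True
  then show ?thesis unfolding poly_growth_def by (intro exI[of _ 0] allI exI[of _ "{}"]) auto
next
  case False
  then obtain U E where U: "subspace U" "module_finite_on X U E"
    and inj: "\<forall>p\<in>poly_ring U. (\<forall>x\<in>X. p x = 0) \<longrightarrow> p = 0"
    using noether_normalization[OF False] by auto
  have "ereal (real (dim U)) \<le> semialgebraic_dim X"
    by (rule dim_le_semialgebraic_dim[OF U]) (use inj in simp)
  also note assms
  finally have "ereal (real (dim U)) \<le> ereal (real k)" .
  then have dk: "dim U \<le> k" by simp
  have fE: "finite E" using U(2) by (auto simp: module_finite_on_def)
  show ?thesis unfolding poly_growth_def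
  proof (intro exI[of _ "card E"] allI)
    fix m
    obtain G where G: "finite G" "card G \<le> (m + 1) ^ dim U"
      "\<And>p. poly_deg U m p \<Longrightarrow> \<exists>c. \<forall>x. p x = (\<Sum>g\<in>G. c g * g x)"
      using poly_deg_spanned[OF U(1), of m] by auto
    let ?h = "\<lambda>(e, g) x. e x * g x" and ?I = "E \<times> G"
    have fI: "finite ?I" using fE G(1) by auto
    have "card (?h ` ?I) \<le> card ?I" by (rule card_image_le) (rule fI)
    also have "\<dots> \<le> card E * (m + 1) ^ k"
      unfolding card_cartesian_product
      by (rule mult_left_mono[OF order_trans[OF G(2) power_increasing[OF dk]]]) auto
    finally have "card (?h ` ?I) \<le> card E * (m + 1) ^ k" .
    moreover have "\<exists>c. \<forall>x\<in>X. p x = (\<Sum>g\<in>?h ` ?I. c g * g x)" if p: "poly_deg UNIV m p" for p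
    proof -
      obtain q where q: "\<And>e. e \<in> E \<Longrightarrow> poly_deg U m (q e)" "\<And>x. x \<in> X \<Longrightarrow> p x = (\<Sum>e\<in>E. q e x * e x)"
        using module_finite_onD[OF U(2) p] by blast
      have "\<forall>e\<in>E. \<exists>c. \<forall>x. q e x = (\<Sum>g\<in>G. c g * g x)" by (intro ballI G(3) q(1))
      then have "\<exists>c. \<forall>e\<in>E. \<forall>x. q e x = (\<Sum>g\<in>G. c e g * g x)" by (rule bchoice)
      then obtain c where c: "\<And>e x. e \<in> E \<Longrightarrow> q e x = (\<Sum>g\<in>G. c e g * g x)" by auto
      define a where "a = (\<lambda>i (x::'a). c (fst i) (snd i))"
      have "p x = (\<Sum>i\<in>?I. a i x * ?h i x)" if x: "x \<in> X" for x
      proof -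
        have "p x = (\<Sum>e\<in>E. \<Sum>g\<in>G. a (e, g) x * ?h (e, g) x)"
          unfolding q(2)[OF x]
        proof (intro sum.cong refl)
          fix e assume e: "e \<in> E"
          show "q e x * e x = (\<Sum>g\<in>G. a (e, g) x * ?h (e, g) x)"
            by (simp add: c[OF e] a_def sum_distrib_left mult_ac)
        qed
        then show ?thesis by (simp add: sum.cartesian_product split_def)
      qed
      moreover define b where "b = (\<lambda>g. \<Sum>i | i \<in> ?I \<and> ?h i = g. c (fst i) (snd i))"
      ultimately have "p x = (\<Sum>g\<in>?h ` ?I. b g * g x)" if "x \<in> X" for x
        using sum_regroup_image[OF fI, of a x ?h] that by (simp add: a_def)
      then show ?thesis by blast
    qed
    moreover have "finite (?h ` ?I)" using fI by auto
    ultimately show "\<exists>G. finite G \<and> card G \<le> card E * (m + 1) ^ k \<and>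
     (\<forall>p. poly_deg UNIV m p \<longrightarrow> (\<exists>c. \<forall>x\<in>X. p x = (\<Sum>g\<in>G. c g * g x)))" by blast
  qed
qed

lemma poly_growth_Un:
  fixes X Y :: "'a::euclidean_space set"
  assumes "poly_growth X k" "poly_growth Y k"
  shows "poly_growth (X \<union> Y) k"
proof -
  obtain C where C: "\<forall>m. \<exists>G. finite G \<and> card G \<le> C * (m + 1) ^ k \<and>
     (\<forall>p. poly_deg UNIV m p \<longrightarrow> (\<exists>c. \<forall>x\<in>X. p x = (\<Sum>g\<in>G. c g * g x)))"
    using assms(1) unfolding poly_growth_def by blast
  obtain D where D: "\<forall>m. \<exists>G. finite G \<and> card G \<le> D * (m + 1) ^ k \<and>
     (\<forall>p. poly_deg UNIV m p \<longrightarrow> (\<exists>c. \<forall>x\<in>Y. p x = (\<Sum>g\<in>G. c g * g x)))"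
    using assms(2) unfolding poly_growth_def by blast
  show ?thesis unfolding poly_growth_def
  proof (intro exI[of _ "C + D"] allI)
    fix m
    obtain G where G: "finite G" "card G \<le> C * (m + 1) ^ k"
      "\<And>p. poly_deg UNIV m p \<Longrightarrow> \<exists>c. \<forall>x\<in>X. p x = (\<Sum>g\<in>G. c g * g x)" using C by blast
    obtain H where H: "finite H" "card H \<le> D * (m + 1) ^ k"
      "\<And>p. poly_deg UNIV m p \<Longrightarrow> \<exists>c. \<forall>x\<in>Y. p x = (\<Sum>g\<in>H. c g * g x)" using D by blast
    \<comment> \<open>Cut the functions off to the disjoint pieces \<open>X\<close> and \<open>Y - X\<close>.\<close>
    define h where "h = (\<lambda>i x. case i of Inl g \<Rightarrow> if x \<in> X then g x else (0::real)
      | Inr g \<Rightarrow> if x \<in> X then 0 else g x)"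
    let ?I = "G <+> H"
    have fI: "finite ?I" using G(1) H(1) by auto
    have "card (h ` ?I) \<le> card ?I" by (rule card_image_le[OF fI])
    also have "\<dots> \<le> (C + D) * (m + 1) ^ k"
      using G(2) H(2) by (simp add: card_Plus[OF G(1) H(1)] distrib_right)
    finally have "card (h ` ?I) \<le> (C + D) * (m + 1) ^ k" .
    moreover have "\<exists>c. \<forall>x\<in>X \<union> Y. p x = (\<Sum>g\<in>h ` ?I. c g * g x)" if p: "poly_deg UNIV m p" for p
    proof -
      obtain c d where c: "\<forall>x\<in>X. p x = (\<Sum>g\<in>G. c g * g x)" and d: "\<forall>x\<in>Y. p x = (\<Sum>g\<in>H. d g * g x)"
        using G(3)[OF p] H(3)[OF p] by blast
      define a where "a = (\<lambda>i. case i of Inl g \<Rightarrow> c g | Inr g \<Rightarrow> d g)"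
      have p_eq: "p x = (\<Sum>i\<in>?I. a i * h i x)" if "x \<in> X \<union> Y" for x
      proof (cases "x \<in> X")
        case True
        then have "p x = (\<Sum>g\<in>G. c g * g x)" using c by blast
        then show ?thesis using True by (simp add: sum.Plus[OF G(1) H(1)] a_def h_def)
      next
        case False
        then have "p x = (\<Sum>g\<in>H. d g * g x)" using d that by blast
        then show ?thesis using False by (simp add: sum.Plus[OF G(1) H(1)] a_def h_def)
      qed
      define b where "b = (\<lambda>g. \<Sum>i | i \<in> ?I \<and> h i = g. a i)"
      have "p x = (\<Sum>g\<in>h ` ?I. b g * g x)" if "x \<in> X \<union> Y" for x
        unfolding p_eq[OF that] b_def using sum_regroup_image[OF fI, of "\<lambda>i _. a i" x h] .
      then show ?thesis by blast
    qed
    moreover have "finite (h ` ?I)" using fI by auto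
    ultimately show "\<exists>G. finite G \<and> card G \<le> (C + D) * (m + 1) ^ k \<and>
     (\<forall>p. poly_deg UNIV m p \<longrightarrow> (\<exists>c. \<forall>x\<in>X \<union> Y. p x = (\<Sum>g\<in>G. c g * g x)))"
      by (intro exI[of _ "h ` ?I"] conjI allI impI)
  qed
qed

section \<open>Secants avoid a subspace\<close>

text \<open>A homogeneous linear system with fewer equations than unknowns has a nontrivial solution.\<close>

lemma homogeneous_system_nontrivial:
  fixes c :: "'i \<Rightarrow> 's \<Rightarrow> real"
  assumes "finite A" "finite I" "card A < card I"
  shows "\<exists>a. (\<exists>i\<in>I. a i \<noteq> 0) \<and> (\<forall>s\<in>A. (\<Sum>i\<in>I. a i * c i s) = 0)"
  using assms
proof (induction A arbitrary: I c rule: finite_induct)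
  case empty
  then have "I \<noteq> {}" by auto
  then show ?case by (intro exI[of _ "\<lambda>_. 1"]) auto
next
  case (insert s A)
  show ?case
  proof (cases "\<forall>i\<in>I. c i s = 0")
    case True
    have "card A < card I" using insert by simp
    then obtain a where "\<exists>i\<in>I. a i \<noteq> 0" "\<forall>s\<in>A. (\<Sum>i\<in>I. a i * c i s) = 0"
      using insert.IH[OF insert.prems(1), of c] by auto
    then show ?thesis using True by (intro exI[of _ a]) auto
  next
    case False
    then obtain k where k: "k \<in> I" "c k s \<noteq> 0" by auto
    let ?I = "I - {k}"
    \<comment> \<open>Eliminate the unknown \<open>k\<close> by means of the equation \<open>s\<close>.\<close>
    define d where "d = (\<lambda>i t. c i t - c i s / c k s * c k t)"
    have "card A < card ?I" using insert k by simp
    moreover have "finite ?I" using insert.prems(1) by simp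
    ultimately obtain a where a: "\<exists>i\<in>?I. a i \<noteq> 0" "\<forall>t\<in>A. (\<Sum>i\<in>?I. a i * d i t) = 0"
      using insert.IH[of ?I d] by auto
    define b where "b = (\<lambda>i. if i = k then - (\<Sum>i\<in>?I. a i * c i s) / c k s else a i)"
    have split: "(\<Sum>i\<in>I. b i * c i t) = b k * c k t + (\<Sum>i\<in>?I. a i * c i t)" for t
    proof -
      have "(\<Sum>i\<in>I. b i * c i t) = b k * c k t + (\<Sum>i\<in>?I. b i * c i t)"
        by (rule sum.remove[OF insert.prems(1) k(1)])
      also have "(\<Sum>i\<in>?I. b i * c i t) = (\<Sum>i\<in>?I. a i * c i t)"
        by (rule sum.cong) (auto simp: b_def)
      finally show ?thesis .
    qed
    have "(\<Sum>i\<in>I. b i * c i s) = 0" unfolding split using k(2) by (simp add: b_def)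
    moreover have "(\<Sum>i\<in>I. b i * c i t) = 0" if "t \<in> A" for t
    proof -
      have "(\<Sum>i\<in>?I. a i * d i t) = (\<Sum>i\<in>?I. a i * c i t) - (\<Sum>i\<in>?I. a i * c i s) / c k s * c k t"
      proof -
        have "(\<Sum>i\<in>?I. a i * d i t) = (\<Sum>i\<in>?I. a i * c i t - a i * c i s / c k s * c k t)"
          by (simp add: d_def right_diff_distrib mult.assoc)
        then show ?thesis by (simp only: sum_subtractf sum_divide_distrib sum_distrib_right)
      qed
      then show ?thesis unfolding split using a(2) that by (simp add: b_def)
    qed
    moreover have "\<exists>i\<in>I. b i \<noteq> 0" using a(1) by (auto simp: b_def)
    ultimately show ?thesis by (intro exI[of _ b]) auto
  qed
qed

lemma poly_deg_of_difference:
  assumes "poly_deg U m p"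
  shows "\<exists>L. (\<forall>ab\<in>set L. poly_deg UNIV m (fst ab) \<and> poly_deg UNIV m (snd ab)) \<and>
    (\<forall>x y. p (x - y) = (\<Sum>ab\<leftarrow>L. fst ab x * snd ab y))"
  using assms
proof (induction rule: poly_deg.induct)
  case (const m c)
  show ?case by (intro exI[of _ "[(\<lambda>x. c, \<lambda>x. 1)]"]) (simp add: poly_deg.const)
next
  case (add m p q)
  obtain L1 where L1: "\<forall>ab\<in>set L1. poly_deg UNIV m (fst ab) \<and> poly_deg UNIV m (snd ab)"
    "\<forall>x y. p (x - y) = (\<Sum>ab\<leftarrow>L1. fst ab x * snd ab y)" using add.IH(1) by auto
  obtain L2 where L2: "\<forall>ab\<in>set L2. poly_deg UNIV m (fst ab) \<and> poly_deg UNIV m (snd ab)"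
    "\<forall>x y. q (x - y) = (\<Sum>ab\<leftarrow>L2. fst ab x * snd ab y)" using add.IH(2) by auto
  show ?case using L1 L2 by (intro exI[of _ "L1 @ L2"]) auto
next
  case (lin m p v)
  obtain L where L: "\<And>ab. ab \<in> set L \<Longrightarrow> poly_deg UNIV m (fst ab) \<and> poly_deg UNIV m (snd ab)"
    "\<And>x y. p (x - y) = (\<Sum>ab\<leftarrow>L. fst ab x * snd ab y)" using lin.IH by auto
  define L1 where "L1 = map (\<lambda>ab. (\<lambda>x. (v \<bullet> x) * fst ab x, snd ab)) L"
  define L2 where "L2 = map (\<lambda>ab. (fst ab, \<lambda>y. (- v \<bullet> y) * snd ab y)) L"
  have "poly_deg UNIV (Suc m) (fst ab) \<and> poly_deg UNIV (Suc m) (snd ab)"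
    if mem: "ab \<in> set (L1 @ L2)" for ab
  proof -
    consider l where "l \<in> set L" "ab = (\<lambda>x. (v \<bullet> x) * fst l x, snd l)"
      | l where "l \<in> set L" "ab = (fst l, \<lambda>y. (- v \<bullet> y) * snd l y)"
      using mem unfolding L1_def L2_def set_append set_map by blast
    then show ?thesis
    proof cases
      case 1
      then show ?thesis using L(1)[OF 1(1)] poly_deg.lin[OF _ UNIV_I, of m "fst l" v] poly_deg_Suc by auto
    next
      case 2
      then show ?thesis using L(1)[OF 2(1)] poly_deg.lin[OF _ UNIV_I, of m "snd l" "- v"] poly_deg_Suc by auto
    qed
  qed
  moreover have "(v \<bullet> (x - y)) * p (x - y) = (\<Sum>ab\<leftarrow>L1 @ L2. fst ab x * snd ab y)" for x y
  proof -
    have "(\<Sum>ab\<leftarrow>L1. fst ab x * snd ab y) = (v \<bullet> x) * (\<Sum>ab\<leftarrow>L. fst ab x * snd ab y)"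
      unfolding L1_def by (simp add: o_def sum_list_const_mult[symmetric] mult.assoc)
    moreover have "(\<Sum>ab\<leftarrow>L2. fst ab x * snd ab y) = (- v \<bullet> y) * (\<Sum>ab\<leftarrow>L. fst ab x * snd ab y)"
      unfolding L2_def map_map o_def sum_list_const_mult[symmetric] by (simp add: mult_ac)
    ultimately show ?thesis by (simp add: L(2) inner_diff_right algebra_simps)
  qed
  ultimately show ?case by (intro exI[of _ "L1 @ L2"] conjI[OF ballI] allI)
qed

text \<open>
  If \<open>G\<close> spans the restrictions to \<open>Z\<close> of the polynomials of degree at most \<open>m\<close>, then the
  products of two members of \<open>G\<close> span the functions \<open>(x, y) \<mapsto> p (x - y)\<close> on \<open>Z \<times> Z\<close>.
\<close>

lemma difference_spanned:
  fixes Z :: "'a::euclidean_space set"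
  assumes "finite G" and span: "\<And>p. poly_deg UNIV m p \<Longrightarrow> \<exists>c. \<forall>x\<in>Z. p x = (\<Sum>g\<in>G. c g * g x)"
    and "poly_deg UNIV m p"
  shows "\<exists>c. \<forall>x\<in>Z. \<forall>y\<in>Z. p (x - y) = (\<Sum>s\<in>G \<times> G. c s * (fst s x * snd s y))"
proof -
  obtain L where L: "\<forall>ab\<in>set L. poly_deg UNIV m (fst ab) \<and> poly_deg UNIV m (snd ab)"
    "\<forall>x y. p (x - y) = (\<Sum>ab\<leftarrow>L. fst ab x * snd ab y)"
    using poly_deg_of_difference[OF assms(3)] by auto
  have "\<exists>c. \<forall>x\<in>Z. \<forall>y\<in>Z. (\<Sum>ab\<leftarrow>L. fst ab x * snd ab y) = (\<Sum>s\<in>G \<times> G. c s * (fst s x * snd s y))"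
    using L(1)
  proof (induction L)
    case Nil
    show ?case by (intro exI[of _ "\<lambda>_. 0"]) simp
  next
    case (Cons ab L)
    obtain c where c: "\<And>x y. x \<in> Z \<Longrightarrow> y \<in> Z \<Longrightarrow>
        (\<Sum>ab\<leftarrow>L. fst ab x * snd ab y) = (\<Sum>s\<in>G \<times> G. c s * (fst s x * snd s y))"
      using Cons by auto
    obtain a where a: "\<And>x. x \<in> Z \<Longrightarrow> fst ab x = (\<Sum>g\<in>G. a g * g x)"
      using span[of "fst ab"] Cons.prems by auto
    obtain b where b: "\<And>x. x \<in> Z \<Longrightarrow> snd ab x = (\<Sum>g\<in>G. b g * g x)"
      using span[of "snd ab"] Cons.prems by auto
    have "fst ab x * snd ab y = (\<Sum>s\<in>G \<times> G. (a (fst s) * b (snd s)) * (fst s x * snd s y))"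
      if "x \<in> Z" "y \<in> Z" for x y
      unfolding a[OF that(1)] b[OF that(2)] sum_product sum.cartesian_product
      by (rule sum.cong) (auto simp: mult_ac)
    then show ?case using c
      by (intro exI[of _ "\<lambda>s. a (fst s) * b (snd s) + c s"]) (simp add: distrib_right sum.distrib)
  qed
  then show ?thesis using L(2) by simp
qed

lemma digit_sum:
  fixes s :: nat
  shows "(\<Sum>i<d. (j div s ^ i mod s) * s ^ i) = j mod s ^ d"
proof (induction d)
  case (Suc d)
  have "j mod (s ^ d * s) = s ^ d * (j div s ^ d mod s) + j mod s ^ d"
    by (rule mod_mult2_eq)
  then show ?case using Suc by (simp add: mult.commute)
qed simp

lemma poly_deg_prod:
  assumes "finite A" "\<And>i. i \<in> A \<Longrightarrow> poly_deg U (m i) (f i)"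
  shows "poly_deg U (\<Sum>i\<in>A. m i) (\<lambda>x. \<Prod>i\<in>A. f i x)"
  using assms by (induction A rule: finite_induct) (auto intro: poly_deg.const poly_deg_mult)

text \<open>
  A set of growth \<open>k\<close> satisfies a homogeneous equation on its differences, in any \<open>d + 1\<close>
  orthonormal coordinates with \<open>d > 2 k\<close>: there are more monomials of degree \<open>N\<close>
  than functions needed to span their restrictions to the differences.
\<close>

lemma homogeneous_equation_of_secants:
  fixes Z :: "'a::euclidean_space set" and b :: "nat \<Rightarrow> 'a"
  assumes Z: "poly_growth Z k" and d: "2 * k + 1 \<le> d"
    and b: "\<And>i j. i \<le> d \<Longrightarrow> j \<le> d \<Longrightarrow> b i \<bullet> b j = (if i = j then 1 else 0)"
  shows "\<exists>G N w. 0 < N \<and> continuous_on UNIV G \<and> (\<forall>t x. G (t *\<^sub>R x) = t ^ N * G x) \<and>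
    (\<forall>x z. (\<forall>i\<le>d. b i \<bullet> z = 0) \<longrightarrow> G (x + z) = G x) \<and>
    (\<forall>x\<in>Z. \<forall>y\<in>Z. G (x - y) = 0) \<and> w \<in> span (b ` {..d}) \<and> G w \<noteq> (0::real)"
proof -
  obtain C where C: "\<And>m. \<exists>G. finite G \<and> card G \<le> C * (m + 1) ^ k \<and>
     (\<forall>p. poly_deg UNIV m p \<longrightarrow> (\<exists>c. \<forall>x\<in>Z. p x = (\<Sum>g\<in>G. c g * g x)))"
    using Z unfolding poly_growth_def by auto
  \<comment> \<open>All but the last exponent range over \<open>0, \<dots>, r\<close>; the last one makes the total degree \<open>N\<close>.\<close>
  define r where "r = C\<^sup>2 * d ^ (2 * k) + 1"
  define s where "s = r + 1"
  define N where "N = d * r"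
  have d0: "0 < d" using d by simp
  have "0 < N" using d0 by (simp add: N_def r_def)
  obtain G where G: "finite G" "card G \<le> C * (N + 1) ^ k"
    "\<And>p. poly_deg UNIV N p \<Longrightarrow> \<exists>c. \<forall>x\<in>Z. p x = (\<Sum>g\<in>G. c g * g x)"
    using C[of N] by auto
  \<comment> \<open>The exponents of the monomial \<open>p j\<close> are the digits of \<open>j\<close> in base \<open>s\<close>.\<close>
  define e where "e = (\<lambda>j i. j div s ^ i mod s)"
  have e_le: "e j i \<le> r" for i j
  proof -
    have "e j i < s" unfolding e_def by (rule mod_less_divisor) (simp add: s_def)
    then show ?thesis by (simp add: s_def)
  qed
  have e_sum: "(\<Sum>i<d. e j i) \<le> N" for j
    using sum_bounded_above[of "{..<d}" "e j" r] e_le by (simp add: N_def)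
  define p where "p = (\<lambda>j x. (\<Prod>i<d. (b i \<bullet> x) ^ e j i) * (b d \<bullet> x) ^ (N - (\<Sum>i<d. e j i)))"
  have p_deg: "poly_deg UNIV N (p j)" for j
  proof -
    have "poly_deg UNIV ((\<Sum>i<d. e j i) + (N - (\<Sum>i<d. e j i))) (p j)"
      unfolding p_def by (intro poly_deg_mult poly_deg_prod poly_deg_power) auto
    then show ?thesis using e_sum[of j] by simp
  qed
  have p_hom: "p j (t *\<^sub>R x) = t ^ N * p j x" for j t x
  proof -
    have "t ^ N = t ^ (\<Sum>i<d. e j i) * t ^ (N - (\<Sum>i<d. e j i))"
      using e_sum[of j] by (simp add: power_add[symmetric])
    then show ?thesis
      by (simp add: p_def power_mult_distrib prod.distrib power_sum mult_ac)
  qed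
  have "\<forall>j. \<exists>c. \<forall>x\<in>Z. \<forall>y\<in>Z. p j (x - y) = (\<Sum>s\<in>G \<times> G. c s * (fst s x * snd s y))"
    by (intro allI difference_spanned[OF G(1,3) p_deg])
  then have "\<exists>c. \<forall>j. \<forall>x\<in>Z. \<forall>y\<in>Z. p j (x - y) = (\<Sum>s\<in>G \<times> G. c j s * (fst s x * snd s y))"
    by (rule choice)
  then obtain c where c: "\<And>j x y. x \<in> Z \<Longrightarrow> y \<in> Z \<Longrightarrow>
      p j (x - y) = (\<Sum>s\<in>G \<times> G. c j s * (fst s x * snd s y))"
    by auto
  have "card (G \<times> G) \<le> (C * (N + 1) ^ k) * (C * (N + 1) ^ k)"
    unfolding card_cartesian_product by (rule mult_mono) (use G(2) in auto)
  also have "\<dots> = C\<^sup>2 * (N + 1) ^ (2 * k)" by (simp add: power2_eq_square power_mult power_mult_distrib mult_ac)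
  also have "\<dots> \<le> C\<^sup>2 * (d * s) ^ (2 * k)"
    using d0 by (intro mult_left_mono power_mono) (auto simp: N_def s_def)
  also have "\<dots> = (C\<^sup>2 * d ^ (2 * k)) * s ^ (2 * k)" by (simp add: power_mult_distrib)
  also have "\<dots> < s * s ^ (2 * k)" by (simp add: s_def r_def)
  also have "\<dots> = s ^ (2 * k + 1)" by simp
  also have "\<dots> \<le> s ^ d" using d by (intro power_increasing) (auto simp: s_def)
  finally have "card (G \<times> G) < card {..<s ^ d}" by simp
  then obtain a where a: "\<exists>j\<in>{..<s ^ d}. a j \<noteq> 0" "\<forall>t\<in>G \<times> G. (\<Sum>j<s ^ d. a j * c j t) = 0"
    using homogeneous_system_nontrivial[of "G \<times> G" "{..<s ^ d}" c] G(1) by auto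
  define H where "H = (\<lambda>x. \<Sum>j<s ^ d. a j * p j x)"
  have "continuous_on UNIV H" unfolding H_def p_def by (intro continuous_intros)
  moreover have "H (t *\<^sub>R x) = t ^ N * H x" for t x
    by (simp add: H_def p_hom sum_distrib_left mult_ac)
  moreover have "H (x + z) = H x" if "\<forall>i\<le>d. b i \<bullet> z = 0" for x z
    using that by (simp add: H_def p_def inner_add_right)
  moreover have "H (x - y) = 0" if "x \<in> Z" "y \<in> Z" for x y
  proof -
    have "H (x - y) = (\<Sum>j<s ^ d. \<Sum>t\<in>G \<times> G. (a j * c j t) * (fst t x * snd t y))"
      unfolding H_def c[OF that] by (simp add: sum_distrib_left mult.assoc)
    also have "\<dots> = (\<Sum>t\<in>G \<times> G. \<Sum>j<s ^ d. (a j * c j t) * (fst t x * snd t y))" by (rule sum.swap)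
    also have "\<dots> = (\<Sum>t\<in>G \<times> G. (\<Sum>j<s ^ d. a j * c j t) * (fst t x * snd t y))"
      by (simp only: sum_distrib_right)
    also have "\<dots> = 0" using a(2) by (intro sum.neutral) simp
    finally show ?thesis .
  qed
  moreover have "\<exists>w\<in>span (b ` {..d}). H w \<noteq> 0"
  proof -
    \<comment> \<open>Kronecker substitution: along \<open>w T\<close> the \<open>j\<close>-th monomial becomes \<open>T ^ j\<close>.\<close>
    define w where "w = (\<lambda>T. (\<Sum>i<d. T ^ (s ^ i) *\<^sub>R b i) + b d)"
    have bw: "b i \<bullet> w T = T ^ (s ^ i)" if "i < d" for i T
    proof -
      have "b i \<bullet> w T = (\<Sum>i'<d. T ^ (s ^ i') * (b i \<bullet> b i')) + b i \<bullet> b d"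
        by (simp add: w_def inner_add_right inner_sum_right)
      also have "(\<Sum>i'<d. T ^ (s ^ i') * (b i \<bullet> b i')) = (\<Sum>i'<d. if i = i' then T ^ (s ^ i') else 0)"
        using that by (intro sum.cong) (auto simp: b)
      finally show ?thesis using that by (simp add: b)
    qed
    have bd: "b d \<bullet> w T = 1" for T
    proof -
      have "b d \<bullet> w T = (\<Sum>i'<d. T ^ (s ^ i') * (b d \<bullet> b i')) + b d \<bullet> b d"
        by (simp add: w_def inner_add_right inner_sum_right)
      also have "(\<Sum>i'<d. T ^ (s ^ i') * (b d \<bullet> b i')) = 0"
        by (intro sum.neutral) (auto simp: b)
      finally show ?thesis by (simp add: b)
    qed
    have pw: "p j (w T) = T ^ j" if "j < s ^ d" for j T
    proof -
      have "p j (w T) = (\<Prod>i<d. T ^ (e j i * s ^ i))"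
        by (simp add: p_def bd bw power_mult[symmetric] mult.commute)
      also have "\<dots> = T ^ (\<Sum>i<d. e j i * s ^ i)" by (simp add: power_sum)
      also have "(\<Sum>i<d. e j i * s ^ i) = j" using digit_sum[of j s d] that by (simp add: e_def)
      finally show ?thesis .
    qed
    have "s ^ d > 0" by (simp add: s_def)
    then obtain n where n: "s ^ d = Suc n" by (cases "s ^ d") auto
    have Hw: "H (w T) = (\<Sum>j\<le>n. a j * T ^ j)" for T
      by (simp add: H_def pw n lessThan_Suc_atMost)
    have "\<exists>j\<le>n. a j \<noteq> 0" using a(1) by (auto simp: n less_Suc_eq_le)
    then have "finite {T. H (w T) = 0}" unfolding Hw polyfun_finite_roots .
    then have "{T. H (w T) = 0} \<noteq> UNIV" using infinite_UNIV_char_0 by auto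
    then obtain T where "H (w T) \<noteq> 0" by auto
    moreover have "w T \<in> span (b ` {..d})"
      unfolding w_def by (intro span_add span_sum span_scale span_base) auto
    ultimately show ?thesis by auto
  qed
  ultimately show ?thesis using \<open>0 < N\<close>
    by (intro exI[of _ H] exI[of _ N]) auto
qed

text \<open>
  \<open>secants_avoid Z W\<close> says that the secant directions of \<open>Z\<close> stay away from \<open>W\<close>, that is,
  that the orthogonal projection along \<open>W\<close> is bi-Lipschitz on \<open>Z\<close>.
\<close>

definition secants_avoid :: "'a::euclidean_space set \<Rightarrow> 'a set \<Rightarrow> bool" where
  "secants_avoid Z W \<longleftrightarrow>
     (\<exists>c>0. \<forall>x\<in>Z. \<forall>y\<in>Z. \<forall>w\<in>W. c * norm (x - y) \<le> norm (x - y - w))"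

text \<open>
  The unit vectors that satisfy the homogeneous equation and keep distance \<open>c\<close> from \<open>W\<close> form a
  compact set disjoint from the span of \<open>W\<close> and \<open>w\<close>, where \<open>w\<close> violates the equation.
\<close>

lemma secants_avoid_enlarge:
  fixes Z W :: "'a::euclidean_space set"
  assumes Z: "poly_growth Z k" and W: "subspace W" "secants_avoid Z W"
    and dim: "dim W + (2 * k + 2) \<le> DIM('a)"
  shows "\<exists>W'. subspace W' \<and> dim W' = Suc (dim W) \<and> secants_avoid Z W'"
proof -
  define V where "V = {y::'a. \<forall>x\<in>W. orthogonal x y}"
  have V: "subspace V" by (auto simp: V_def subspace_def orthogonal_def inner_add_right)
  have dimV: "dim V + dim W = DIM('a)"
    using dim_subspace_orthogonal_to_vectors[OF W(1) subspace_UNIV] by (simp add: V_def)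
  obtain B where B: "B \<subseteq> V" "pairwise orthogonal B" "\<And>x. x \<in> B \<Longrightarrow> norm x = 1"
    "independent B" "card B = dim V" "span B = V"
    using orthonormal_basis_subspace[OF V] by metis
  have "finite B" using B(4) by (rule independent_imp_finite)
  then obtain b where b: "bij_betw b {0..<dim V} B"
    using ex_bij_betw_nat_finite[of B] B(5) by auto
  define d where "d = dim V - 1"
  have dV: "dim V = Suc d" "2 * k + 1 \<le> d" using dim dimV by (auto simp: d_def)
  have set: "{0..<dim V} = {..d}" using dV(1) by auto
  have bB: "b i \<in> B" if "i \<le> d" for i using b that unfolding set bij_betw_def by auto
  have orth: "b i \<bullet> b j = (if i = j then 1 else 0)" if ij: "i \<le> d" "j \<le> d" for i j
  proof (cases "i = j")
    case True
    then show ?thesis using B(3)[OF bB[OF ij(1)]] by (simp add: norm_eq_1)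
  next
    case False
    then have "b i \<noteq> b j" using b ij unfolding set bij_betw_def inj_on_def by auto
    then have "orthogonal (b i) (b j)"
      using B(2) bB[OF ij(1)] bB[OF ij(2)] by (auto simp: pairwise_def)
    then show ?thesis using False by (simp add: orthogonal_def)
  qed
  have "b ` {..d} = B" using b unfolding set bij_betw_def by auto
  then have spb: "span (b ` {..d}) = V" using B(6) by simp
  obtain G N w where G: "0 < N" "continuous_on UNIV G" "\<And>t x. G (t *\<^sub>R x) = t ^ N * G x"
    "\<And>x z. \<forall>i\<le>d. b i \<bullet> z = 0 \<Longrightarrow> G (x + z) = G x"
    "\<And>x y. x \<in> Z \<Longrightarrow> y \<in> Z \<Longrightarrow> G (x - y) = 0" "w \<in> V" "G w \<noteq> (0::real)"
    using homogeneous_equation_of_secants[OF Z dV(2) orth] unfolding spb by auto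
  have Winv: "G (x + z) = G x" if z: "z \<in> W" for x z
  proof (rule G(4), intro allI impI)
    fix i assume "i \<le> d"
    then have "b i \<in> V" using bB B(1) by auto
    then show "b i \<bullet> z = 0" using z by (auto simp: V_def orthogonal_def inner_commute)
  qed
  have G0: "G 0 = 0" using G(3)[of 0 0] G(1) by (simp add: power_0_left)
  have "w \<notin> W" using Winv[of w 0] G(7) G0 by auto
  define W' where "W' = span (insert w W)"
  have W': "subspace W'" by (simp add: W'_def)
  have sW: "span W = W" using W(1) by simp
  have dimW': "dim W' = Suc (dim W)" unfolding W'_def dim_span by (simp add: dim_insert sW \<open>w \<notin> W\<close>)
  obtain c where c: "0 < c" "\<And>x y w. x \<in> Z \<Longrightarrow> y \<in> Z \<Longrightarrow> w \<in> W \<Longrightarrow> c * norm (x - y) \<le> norm (x - y - w)"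
    using W(2) unfolding secants_avoid_def by auto
  define K where "K = {z. norm z = 1} \<inter> {z. G z = 0} \<inter> (\<Inter>w\<in>W. {z. c \<le> norm (z - w)})"
  have "compact K"
  proof -
    have "compact {z::'a. norm z = 1}" using compact_sphere[of "0::'a" 1] by (simp add: sphere_def)
    moreover have "closed {z. G z = 0}" by (intro closed_Collect_eq G(2) continuous_on_const)
    moreover have "closed (\<Inter>w\<in>W. {z. c \<le> norm (z - w)})"
      by (intro closed_INT ballI closed_Collect_le continuous_intros)
    ultimately show ?thesis unfolding K_def by (intro compact_Int_closed)
  qed
  have notW': "z \<notin> W'" if z: "z \<in> K" for z
  proof
    assume "z \<in> W'"
    then obtain l where l: "z - l *\<^sub>R w \<in> W" unfolding W'_def span_insert sW by auto
    have "G z = G (l *\<^sub>R w)" using Winv[OF l, of "l *\<^sub>R w"] by simp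
    then have "l ^ N * G w = 0" using z G(3) by (simp add: K_def)
    then have "l = 0" using G(7) by simp
    then have "z \<in> W" using l by simp
    then have "c \<le> norm (z - z)" using z unfolding K_def by blast
    then show False using c(1) by simp
  qed
  have "\<exists>e>0. \<forall>z\<in>K. e \<le> infdist z W'"
  proof (cases "K = {}")
    case True
    then show ?thesis by (intro exI[of _ 1]) auto
  next
    case False
    obtain z0 where z0: "z0 \<in> K" "\<And>z. z \<in> K \<Longrightarrow> infdist z0 W' \<le> infdist z W'"
      using continuous_attains_inf[OF \<open>compact K\<close> False continuous_on_infdist[OF continuous_on_id, of K W']]
      by auto
    have "W' \<noteq> {}" using subspace_0[OF W'] by auto
    then have "infdist z0 W' > 0"
      using infdist_pos_not_in_closed[OF closed_subspace[OF W'] _ notW'[OF z0(1)]] by simp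
    then show ?thesis using z0(2) by (intro exI[of _ "infdist z0 W'"]) auto
  qed
  then obtain e where e: "0 < e" "\<And>z. z \<in> K \<Longrightarrow> e \<le> infdist z W'" by auto
  have "e * norm (x - y) \<le> norm (x - y - v)" if xy: "x \<in> Z" "y \<in> Z" and v: "v \<in> W'" for x y v
  proof (cases "x = y")
    case False
    define n where "n = norm (x - y)"
    have n: "n > 0" using False by (simp add: n_def)
    define z where "z = (1 / n) *\<^sub>R (x - y)"
    have xyz: "x - y = n *\<^sub>R z" using n by (simp add: z_def)
    have "norm z = 1" using n by (simp add: z_def n_def)
    moreover have "G z = 0" unfolding z_def G(3) using G(5)[OF xy] by simp
    moreover have "c \<le> norm (z - u)" if "u \<in> W" for u
    proof -
      have "n *\<^sub>R u \<in> W" using that W(1) by (rule subspace_scale[rotated])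
      then have "c * n \<le> norm (x - y - n *\<^sub>R u)" using c(2)[OF xy] by (simp add: n_def)
      also have "\<dots> = norm (n *\<^sub>R (z - u))" by (simp add: xyz scaleR_diff_right)
      also have "\<dots> = n * norm (z - u)" using n by simp
      finally show ?thesis using n by (simp add: mult.commute)
    qed
    ultimately have "z \<in> K" by (simp add: K_def)
    have "(1 / n) *\<^sub>R v \<in> W'" using v W' by (rule subspace_scale[rotated])
    then have "infdist z W' \<le> dist z ((1 / n) *\<^sub>R v)" by (rule infdist_le)
    then have "e \<le> norm (z - (1 / n) *\<^sub>R v)" using e(2)[OF \<open>z \<in> K\<close>] by (simp add: dist_norm)
    then have "n * e \<le> n * norm (z - (1 / n) *\<^sub>R v)" using n by simp
    also have "\<dots> = norm (n *\<^sub>R (z - (1 / n) *\<^sub>R v))" using n by simp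
    also have "\<dots> = norm (x - y - v)" using n by (simp add: xyz scaleR_diff_right)
    finally show ?thesis by (simp add: n_def mult.commute)
  qed simp
  then have "secants_avoid Z W'" unfolding secants_avoid_def using e(1) by auto
  then show ?thesis using W' dimW' by auto
qed

lemma subspace_avoiding_secants_exists:
  fixes Z :: "'a::euclidean_space set"
  assumes Z: "poly_growth Z k" and "q + (2 * k + 1) \<le> DIM('a)"
  shows "\<exists>W. subspace W \<and> dim W = q \<and> secants_avoid Z W"
  using assms(2)
proof (induction q)
  case 0
  have "secants_avoid Z {0}" unfolding secants_avoid_def by (intro exI[of _ 1]) auto
  then show ?case by (intro exI[of _ "{0}"]) auto
next
  case (Suc q)
  then obtain W where W: "subspace W" "dim W = q" "secants_avoid Z W" by auto
  then show ?case using secants_avoid_enlarge[OF Z W(1,3)] Suc.prems by auto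
qed

section \<open>Tame shears\<close>

lemma bilipschitz_homeomorphism_UNIV:
  fixes F G :: "'a::metric_space \<Rightarrow> 'a"
  assumes "C-lipschitz_on UNIV F" "D-lipschitz_on UNIV G" "\<And>x. G (F x) = x" "\<And>x. F (G x) = x"
  shows "bilipschitz_homeomorphism UNIV UNIV F"
proof -
  have "inv_into UNIV F = G" by (rule inv_equality) (simp_all add: assms(3,4))
  moreover have "bij F" by (rule bij_betw_byWitness[of _ G]) (simp_all add: assms(3,4))
  ultimately show ?thesis unfolding bilipschitz_homeomorphism_def using assms(1,2) by auto
qed

lemma bilipschitz_homeomorphism_UNIV_comp:
  fixes F G :: "'a::metric_space \<Rightarrow> 'a"
  assumes "bilipschitz_homeomorphism UNIV UNIV F" "bilipschitz_homeomorphism UNIV UNIV G"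
  shows "bilipschitz_homeomorphism UNIV UNIV (F \<circ> G)"
proof -
  obtain C C' where F: "bij F" "C-lipschitz_on UNIV F" "C'-lipschitz_on UNIV (inv_into UNIV F)"
    using assms(1) by (auto simp: bilipschitz_homeomorphism_def)
  obtain D D' where G: "bij G" "D-lipschitz_on UNIV G" "D'-lipschitz_on UNIV (inv_into UNIV G)"
    using assms(2) by (auto simp: bilipschitz_homeomorphism_def)
  have "(C * D)-lipschitz_on UNIV (F \<circ> G)"
    by (rule lipschitz_on_compose[OF G(2) lipschitz_on_subset[OF F(2)]]) auto
  moreover have "(D' * C')-lipschitz_on UNIV (inv_into UNIV G \<circ> inv_into UNIV F)"
    by (rule lipschitz_on_compose[OF F(3) lipschitz_on_subset[OF G(3)]]) auto
  ultimately show ?thesis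
    unfolding bilipschitz_homeomorphism_def o_inv_distrib[OF F(1) G(1)]
    using bij_comp[OF G(1) F(1)] by auto
qed

lemma tame_bilipschitz_comp:
  assumes "tame_bilipschitz F" "tame_bilipschitz G"
  shows "tame_bilipschitz (F \<circ> G)"
  using assms bilipschitz_homeomorphism_UNIV_comp tame_composition.comp
  unfolding tame_bilipschitz_def by blast

lemma orthogonal_transformation_tame:
  fixes R :: "real^'n::{finite,linorder} \<Rightarrow> real^'n::{finite,linorder}"
  assumes "orthogonal_transformation R" "det (matrix R) = 1"
  shows "tame_bilipschitz R"
proof -
  have lip: "1-lipschitz_on UNIV T" if "orthogonal_transformation T" for T :: "(real, 'n) vec \<Rightarrow> (real, 'n) vec"
    using that by (auto simp: lipschitz_on_def orthogonal_transformation_isometry)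
  have bij: "bij R" by (rule orthogonal_transformation_bij[OF assms(1)])
  have "bilipschitz_homeomorphism UNIV UNIV R"
    by (rule bilipschitz_homeomorphism_UNIV[OF lip[OF assms(1)] lip[OF orthogonal_transformation_inv[OF assms(1)]]])
      (simp_all add: bij bij_is_inj bij_is_surj surj_f_inv_f)
  moreover have "tame_composition R"
    using assms by (intro tame_composition.linear orthogonal_transformation_linear)
  ultimately show ?thesis by (simp add: tame_bilipschitz_def)
qed

lemma lipschitz_scaleR_unit:
  fixes p :: "'a::metric_space \<Rightarrow> real" and u :: "'b::real_normed_vector"
  assumes "C-lipschitz_on UNIV p" "norm u = 1"
  shows "C-lipschitz_on UNIV (\<lambda>x. p x *\<^sub>R u)"
proof (rule lipschitz_onI)
  show "dist (p x *\<^sub>R u) (p y *\<^sub>R u) \<le> C * dist x y" for x y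
    using lipschitz_onD[OF assms(1), of x y] assms(2)
    by (simp add: dist_norm scaleR_diff_left[symmetric])
qed (rule lipschitz_on_nonneg[OF assms(1)])

lemma bilipschitz_shear:
  fixes p :: "'a::real_normed_vector \<Rightarrow> real"
  assumes "C-lipschitz_on UNIV p" "norm u = 1" "\<And>x t. p (x + t *\<^sub>R u) = p x"
  shows "bilipschitz_homeomorphism UNIV UNIV (\<lambda>x. x + p x *\<^sub>R u)"
proof (rule bilipschitz_homeomorphism_UNIV)
  note l = lipschitz_scaleR_unit[OF assms(1,2)]
  show "(1 + C)-lipschitz_on UNIV (\<lambda>x. x + p x *\<^sub>R u)"
    by (rule lipschitz_on_add[OF lipschitz_on_id l])
  show "(1 + C)-lipschitz_on UNIV (\<lambda>x. x - p x *\<^sub>R u)"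
    by (rule lipschitz_on_diff[OF lipschitz_on_id l])
  show "x + p x *\<^sub>R u - p (x + p x *\<^sub>R u) *\<^sub>R u = x" for x by (simp add: assms(3))
  show "x - p x *\<^sub>R u + p (x - p x *\<^sub>R u) *\<^sub>R u = x" for x
    using assms(3)[of x "- p x"] by simp
qed

text \<open>A rotation carries the last basis vector to \<open>u\<close> and conjugates a shear of the last coordinate.\<close>

lemma tame_shear_direction:
  fixes p :: "real^'n::{finite,linorder} \<Rightarrow> real" and u :: "real^'n::{finite,linorder}"
  assumes n: "2 \<le> CARD('n)" and p: "C-lipschitz_on UNIV p" and u: "norm u = 1"
    and inv: "\<And>x t. p (x + t *\<^sub>R u) = p x"
  shows "tame_bilipschitz (\<lambda>x. x + p x *\<^sub>R u)"
proof -
  let ?l = "last_index :: 'n"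
  define e where "e = (axis ?l 1 :: (real, 'n) vec)"
  have e: "norm e = 1" by (simp add: e_def)
  obtain R where R: "orthogonal_transformation R" "det (matrix R) = 1" "R e = u"
    using rotation_exists[OF n, of e u] e u by metis
  let ?R' = "inv_into UNIV R"
  have R': "orthogonal_transformation ?R'" by (rule orthogonal_transformation_inv[OF R(1)])
  note lin = orthogonal_transformation_linear[OF R(1)] and lin' = orthogonal_transformation_linear[OF R']
  have bij: "bij R" by (rule orthogonal_transformation_bij[OF R(1)])
  have RR': "R (?R' x) = x" for x using bij by (simp add: bij_is_surj surj_f_inv_f)
  have "R \<circ> ?R' = id" using RR' by auto
  then have "matrix R ** matrix ?R' = mat 1"
    using matrix_compose[OF lin' lin] by (simp add: matrix_id_mat_1)
  then have "det (matrix R) * det (matrix ?R') = 1" by (metis det_mul det_I)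
  then have det': "det (matrix ?R') = 1" using R(2) by simp
  define q where "q = (\<lambda>z. p (R z))"
  have q_lip: "C-lipschitz_on UNIV q"
  proof (rule lipschitz_onI)
    fix x y
    have "dist (R x) (R y) = dist x y" using R(1) by (simp add: orthogonal_transformation_isometry)
    then show "dist (q x) (q y) \<le> C * dist x y"
      using lipschitz_onD[OF p, of "R x" "R y"] by (simp add: q_def)
  qed (rule lipschitz_on_nonneg[OF p])
  have R_add: "R (x + t *\<^sub>R e) = R x + t *\<^sub>R u" for x t
    by (simp add: linear_add[OF lin] linear_scale[OF lin] R(3))
  have q_inv: "q (z + t *\<^sub>R e) = q z" for z t by (simp add: q_def R_add inv)
  have "last_coordinate_shear (\<lambda>z. z + q z *\<^sub>R e)"
    unfolding last_coordinate_shear_def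
  proof (intro exI[of _ q] conjI allI impI)
    fix x y :: "(real, 'n) vec" assume eq: "\<forall>i. i \<noteq> ?l \<longrightarrow> x $ i = y $ i"
    have "y = x + (y $ ?l - x $ ?l) *\<^sub>R e"
      using eq by (auto simp: vec_eq_iff e_def axis_def)
    then show "q x = q y" using q_inv by metis
  qed (auto simp: fun_eq_iff vec_eq_iff e_def axis_def)
  moreover have "bilipschitz_homeomorphism UNIV UNIV (\<lambda>z. z + q z *\<^sub>R e)"
    by (rule bilipschitz_shear[OF q_lip e q_inv])
  ultimately have "tame_bilipschitz (\<lambda>z. z + q z *\<^sub>R e)"
    by (simp add: tame_bilipschitz_def tame_composition.shear)
  then have "tame_bilipschitz (R \<circ> ((\<lambda>z. z + q z *\<^sub>R e) \<circ> ?R'))"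
    by (intro tame_bilipschitz_comp orthogonal_transformation_tame[OF R(1,2)]
        orthogonal_transformation_tame[OF R' det'])
  moreover have "R \<circ> ((\<lambda>z. z + q z *\<^sub>R e) \<circ> ?R') = (\<lambda>x. x + p x *\<^sub>R u)"
    by (auto simp: fun_eq_iff R_add RR' q_def)
  ultimately show ?thesis by simp
qed

lemma tame_bilipschitz_ident: "tame_bilipschitz (\<lambda>x :: real^'n::{finite,linorder}. x)"
proof -
  have "matrix (\<lambda>x :: (real, 'n) vec. x) = mat 1" using matrix_id_mat_1 by (simp add: id_def)
  then show ?thesis
    by (intro orthogonal_transformation_tame) (simp_all add: orthogonal_transformation_def linear_id[unfolded id_def])
qed

text \<open>
  A shear along a subspace \<open>W\<close> is a composition of shears along the vectors of an orthonormal
  basis of \<open>W\<close>.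
\<close>

lemma tame_shear_subspace:
  fixes \<phi> :: "real^'n::{finite,linorder} \<Rightarrow> real^'n::{finite,linorder}"
  assumes n: "2 \<le> CARD('n)" and W: "subspace W" and \<phi>: "C-lipschitz_on UNIV \<phi>"
    "\<And>x. \<phi> x \<in> W" "\<And>x w. w \<in> W \<Longrightarrow> \<phi> (x + w) = \<phi> x"
  shows "tame_bilipschitz (\<lambda>x. x + \<phi> x)"
proof -
  obtain B where B: "B \<subseteq> W" "pairwise orthogonal B" "\<And>x. x \<in> B \<Longrightarrow> norm x = 1"
    "independent B" "span B = W"
    using orthonormal_basis_subspace[OF W] by metis
  have "finite B" using B(4) by (rule independent_imp_finite)
  have "tame_bilipschitz (\<lambda>x. x + (\<Sum>b\<in>A. (\<phi> x \<bullet> b) *\<^sub>R b))" if "A \<subseteq> B" for A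
    using finite_subset[OF that \<open>finite B\<close>] that
  proof (induction A rule: finite_induct)
    case empty
    then show ?case by (simp add: tame_bilipschitz_ident)
  next
    case (insert b A)
    have b: "b \<in> B" "b \<in> W" "norm b = 1" using insert.prems B(1,3) by auto
    have "tame_bilipschitz (\<lambda>x. x + (\<phi> x \<bullet> b) *\<^sub>R b)"
    proof (rule tame_shear_direction[OF n _ b(3)])
      show "C-lipschitz_on UNIV (\<lambda>x. \<phi> x \<bullet> b)"
      proof (rule lipschitz_onI)
        fix x y
        have "\<bar>(\<phi> x - \<phi> y) \<bullet> b\<bar> \<le> norm (\<phi> x - \<phi> y) * norm b" by (rule Cauchy_Schwarz_ineq2)
        then show "dist (\<phi> x \<bullet> b) (\<phi> y \<bullet> b) \<le> C * dist x y"
          using lipschitz_onD[OF \<phi>(1), of x y] b(3) by (simp add: dist_norm inner_diff_left)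
      qed (rule lipschitz_on_nonneg[OF \<phi>(1)])
      show "\<phi> (x + t *\<^sub>R b) \<bullet> b = \<phi> x \<bullet> b" for x t
        using \<phi>(3)[OF subspace_scale[OF W b(2)]] by simp
    qed
    then have "tame_bilipschitz ((\<lambda>x. x + (\<phi> x \<bullet> b) *\<^sub>R b) \<circ> (\<lambda>x. x + (\<Sum>b\<in>A. (\<phi> x \<bullet> b) *\<^sub>R b)))"
      using insert by (intro tame_bilipschitz_comp) auto
    moreover have "\<phi> (x + (\<Sum>b\<in>A. (\<phi> x \<bullet> b) *\<^sub>R b)) = \<phi> x" for x
      using insert.prems B(1) by (intro \<phi>(3) subspace_sum[OF W] subspace_scale[OF W]) auto
    ultimately show ?case using insert.hyps by (simp add: o_def add_ac)
  qed
  moreover have "(\<Sum>b\<in>B. (\<phi> x \<bullet> b) *\<^sub>R b) = \<phi> x" for x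
    by (rule orthonormal_basis_expand[OF B(2,3) _ \<open>finite B\<close>]) (use \<phi>(2) B(5) in auto)
  ultimately show ?thesis using \<open>finite B\<close> by (metis (no_types, lifting) ext order_refl)
qed

section \<open>Extension of Lipschitz maps\<close>

text \<open>
  McShane's extension: the function prescribed on the points \<open>\<alpha> s\<close> by the values \<open>f s\<close>
  is extended with the same Lipschitz constant.
\<close>

lemma lipschitz_extension_real:
  fixes \<alpha> :: "'s \<Rightarrow> 'a::metric_space" and f :: "'s \<Rightarrow> real"
  assumes f: "\<And>s t. s \<in> S \<Longrightarrow> t \<in> S \<Longrightarrow> \<bar>f s - f t\<bar> \<le> L * dist (\<alpha> s) (\<alpha> t)" and "0 \<le> L"
  shows "\<exists>g. L-lipschitz_on UNIV g \<and> (\<forall>s\<in>S. g (\<alpha> s) = f s)"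
proof (cases "S = {}")
  case True
  have "L-lipschitz_on UNIV (\<lambda>x::'a. 0::real)"
    using \<open>0 \<le> L\<close> by (intro lipschitz_onI) auto
  then show ?thesis using True by auto
next
  case False
  define g where "g = (\<lambda>x. INF s\<in>S. f s + L * dist x (\<alpha> s))"
  have bdd: "bdd_below ((\<lambda>s. f s + L * dist x (\<alpha> s)) ` S)" for x
  proof -
    obtain s0 where s0: "s0 \<in> S" using False by auto
    have "f s0 - L * dist (\<alpha> s0) x \<le> f s + L * dist x (\<alpha> s)" if "s \<in> S" for s
    proof -
      have "L * dist (\<alpha> s0) (\<alpha> s) \<le> L * (dist (\<alpha> s0) x + dist x (\<alpha> s))"
        using \<open>0 \<le> L\<close> by (intro mult_left_mono dist_triangle)
      then show ?thesis using f[OF s0 that] by (simp add: distrib_left)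
    qed
    then show ?thesis by (auto simp: bdd_below_def)
  qed
  have le: "g x \<le> g y + L * dist x y" for x y
  proof -
    have "g x - L * dist x y \<le> f s + L * dist y (\<alpha> s)" if "s \<in> S" for s
    proof -
      have "g x \<le> f s + L * dist x (\<alpha> s)" unfolding g_def by (rule cINF_lower[OF bdd that])
      also have "L * dist x (\<alpha> s) \<le> L * (dist x y + dist y (\<alpha> s))"
        using \<open>0 \<le> L\<close> by (intro mult_left_mono dist_triangle)
      finally show ?thesis by (simp add: distrib_left)
    qed
    then have "g x - L * dist x y \<le> g y" unfolding g_def[of] by (intro cINF_greatest[OF False])
    then show ?thesis by simp
  qed
  have "L-lipschitz_on UNIV g"
  proof (rule lipschitz_onI[OF _ \<open>0 \<le> L\<close>])
    show "dist (g x) (g y) \<le> L * dist x y" for x y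
      using le[of x y] le[of y x] by (simp add: dist_real_def dist_commute abs_le_iff)
  qed
  moreover have "g (\<alpha> s) = f s" if s: "s \<in> S" for s
  proof (rule antisym)
    show "g (\<alpha> s) \<le> f s" unfolding g_def using cINF_lower[OF bdd s, of "\<alpha> s"] by simp
    show "f s \<le> g (\<alpha> s)" unfolding g_def
    proof (rule cINF_greatest[OF False])
      fix t assume "t \<in> S"
      then show "f s \<le> f t + L * dist (\<alpha> s) (\<alpha> t)" using f[OF s] by fastforce
    qed
  qed
  ultimately show ?thesis by auto
qed

lemma lipschitz_extension_subspace:
  fixes \<alpha> :: "'s \<Rightarrow> 'a::metric_space" and \<beta> :: "'s \<Rightarrow> 'b::euclidean_space"
  assumes W: "subspace W" and \<beta>: "\<And>s. s \<in> S \<Longrightarrow> \<beta> s \<in> W"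
    and lip: "\<And>s t. s \<in> S \<Longrightarrow> t \<in> S \<Longrightarrow> norm (\<beta> s - \<beta> t) \<le> L * dist (\<alpha> s) (\<alpha> t)" and "0 \<le> L"
  shows "\<exists>g C. C-lipschitz_on UNIV g \<and> (\<forall>x. g x \<in> W) \<and> (\<forall>s\<in>S. g (\<alpha> s) = \<beta> s)"
proof -
  obtain B where B: "B \<subseteq> W" "pairwise orthogonal B" "\<And>x. x \<in> B \<Longrightarrow> norm x = 1"
    "independent B" "span B = W"
    using orthonormal_basis_subspace[OF W] by metis
  have "finite B" using B(4) by (rule independent_imp_finite)
  have "\<exists>g. L-lipschitz_on UNIV g \<and> (\<forall>s\<in>S. g (\<alpha> s) = \<beta> s \<bullet> b)" if b: "b \<in> B" for b
  proof (rule lipschitz_extension_real[OF _ \<open>0 \<le> L\<close>])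
    fix s t assume st: "s \<in> S" "t \<in> S"
    have "\<bar>(\<beta> s - \<beta> t) \<bullet> b\<bar> \<le> norm (\<beta> s - \<beta> t) * norm b" by (rule Cauchy_Schwarz_ineq2)
    then show "\<bar>\<beta> s \<bullet> b - \<beta> t \<bullet> b\<bar> \<le> L * dist (\<alpha> s) (\<alpha> t)"
      using lip[OF st] B(3)[OF b] by (simp add: inner_diff_left)
  qed
  then have "\<forall>b\<in>B. \<exists>g. L-lipschitz_on UNIV g \<and> (\<forall>s\<in>S. g (\<alpha> s) = \<beta> s \<bullet> b)" by blast
  then have "\<exists>g. \<forall>b\<in>B. L-lipschitz_on UNIV (g b) \<and> (\<forall>s\<in>S. g b (\<alpha> s) = \<beta> s \<bullet> b)" by (rule bchoice)
  then obtain g where g: "\<And>b. b \<in> B \<Longrightarrow> L-lipschitz_on UNIV (g b)"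
    "\<And>b s. b \<in> B \<Longrightarrow> s \<in> S \<Longrightarrow> g b (\<alpha> s) = \<beta> s \<bullet> b" by auto
  define h where "h = (\<lambda>x. \<Sum>b\<in>B. g b x *\<^sub>R b)"
  have "(real (card B) * L)-lipschitz_on UNIV h"
  proof (rule lipschitz_onI)
    fix x y
    have "norm (h x - h y) = norm (\<Sum>b\<in>B. (g b x - g b y) *\<^sub>R b)"
      by (simp add: h_def scaleR_diff_left sum_subtractf)
    also have "\<dots> \<le> (\<Sum>b\<in>B. norm ((g b x - g b y) *\<^sub>R b))" by (rule norm_sum)
    also have "\<dots> \<le> (\<Sum>b\<in>B. L * dist x y)"
    proof (rule sum_mono)
      fix b assume b: "b \<in> B"
      show "norm ((g b x - g b y) *\<^sub>R b) \<le> L * dist x y"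
        using lipschitz_onD[OF g(1)[OF b], of x y] B(3)[OF b] by (simp add: dist_norm)
    qed
    finally show "dist (h x) (h y) \<le> real (card B) * L * dist x y" by (simp add: dist_norm)
  qed (use \<open>0 \<le> L\<close> in simp)
  moreover have "h x \<in> W" for x
    unfolding h_def using B(1) by (intro subspace_sum[OF W] subspace_scale[OF W]) auto
  moreover have "h (\<alpha> s) = \<beta> s" if s: "s \<in> S" for s
  proof -
    have "h (\<alpha> s) = (\<Sum>b\<in>B. (\<beta> s \<bullet> b) *\<^sub>R b)" unfolding h_def by (rule sum.cong) (auto simp: g(2) s)
    also have "\<dots> = \<beta> s"
      by (rule orthonormal_basis_expand[OF B(2,3) _ \<open>finite B\<close>]) (use \<beta>[OF s] B(5) in auto)
    finally show ?thesis .
  qed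
  ultimately show ?thesis by (intro exI[of _ h] exI[of _ "real (card B) * L"]) auto
qed

section \<open>The extension theorem\<close>

lemma orthogonal_projections:
  fixes W :: "'a::euclidean_space set"
  assumes W: "subspace W"
  shows "\<exists>V P. subspace V \<and> dim V + dim W = DIM('a) \<and> linear P \<and>
    (\<forall>x. P x \<in> V \<and> x - P x \<in> W) \<and> (\<forall>v\<in>V. P v = v) \<and> (\<forall>w\<in>W. P w = 0)"
proof -
  define V where "V = {y::'a. \<forall>x\<in>W. orthogonal x y}"
  have V: "subspace V" by (auto simp: V_def subspace_def orthogonal_def inner_add_right)
  have dimV: "dim V + dim W = DIM('a)"
    using dim_subspace_orthogonal_to_vectors[OF W subspace_UNIV] by (simp add: V_def)
  obtain B where B: "B \<subseteq> V" "pairwise orthogonal B" "\<And>x. x \<in> B \<Longrightarrow> norm x = 1"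
    "independent B" "span B = V"
    using orthonormal_basis_subspace[OF V] by metis
  have "finite B" using B(4) by (rule independent_imp_finite)
  define P where "P = (\<lambda>x. \<Sum>b\<in>B. (x \<bullet> b) *\<^sub>R b)"
  have P: "linear P"
    unfolding P_def by (intro linear_compose_sum ballI linear_compose_scale_right linearI)
      (simp_all add: inner_add_left scaleR_add_left)
  have PV: "P x \<in> V" for x
    unfolding P_def using B(1) by (intro subspace_sum[OF V] subspace_scale[OF V]) auto
  have Pv: "P v = v" if "v \<in> V" for v
    unfolding P_def by (rule orthonormal_basis_expand[OF B(2,3) _ \<open>finite B\<close>]) (use that B(5) in auto)
  have Pw: "P w = 0" if "w \<in> W" for w
    unfolding P_def using that B(1) by (intro sum.neutral) (auto simp: V_def orthogonal_def)
  have "x - P x \<in> W" for x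
  proof -
    obtain y z where yz: "y \<in> span W" "\<And>w. w \<in> span W \<Longrightarrow> orthogonal z w" "x = y + z"
      using orthogonal_subspace_decomp_exists[of W x] by metis
    have "y \<in> W" using yz(1) W by (metis span_eq_iff)
    moreover have "z \<in> V" unfolding V_def using yz(2) by (auto simp: orthogonal_commute intro: span_base)
    ultimately have "P x = z" by (simp add: yz(3) linear_add[OF P] Pw Pv)
    then show ?thesis using \<open>y \<in> W\<close> yz(3) by simp
  qed
  then show ?thesis using V dimV P PV Pv Pw by (intro exI[of _ V] exI[of _ P]) auto
qed

text \<open>
  The geometric part: three shears, alternately along \<open>W\<close> and along its complement \<open>V\<close>,
  move \<open>X\<close> to \<open>Y\<close> as prescribed by \<open>f\<close>.
\<close>

lemma extension_by_three_shears:
  fixes X Y W :: "(real^'n::{finite,linorder}) set"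
    and f :: "real^'n::{finite,linorder} \<Rightarrow> real^'n::{finite,linorder}"
  assumes n: "2 \<le> CARD('n)" and W: "subspace W" "CARD('n) \<le> 2 * dim W"
    and avoid: "secants_avoid (X \<union> Y) W" and f: "bilipschitz_homeomorphism X Y f"
  shows "\<exists>F :: real \<Rightarrow> real^'n::{finite,linorder} \<Rightarrow> real^'n::{finite,linorder}.
            (\<forall>t. tame_bilipschitz (F t)) \<and>
            continuous_on UNIV (\<lambda>(x, t). F t x) \<and>
            F 0 = id \<and> (\<forall>x\<in>X. F 1 x = f x)"
proof -
  obtain V P where V: "subspace V" "dim V + dim W = DIM((real, 'n) vec)" and P: "linear P"
    and PV: "\<And>x. P x \<in> V" and QW: "\<And>x. x - P x \<in> W"
    and Pv: "\<And>v. v \<in> V \<Longrightarrow> P v = v" and Pw: "\<And>w. w \<in> W \<Longrightarrow> P w = 0"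
    using orthogonal_projections[OF W(1)] by auto
  define Q where "Q = (\<lambda>x. x - P x)"
  have Q: "linear Q" unfolding Q_def by (intro linear_compose_sub P linear_ident)
  have QW: "Q x \<in> W" for x using QW by (simp add: Q_def)
  have PQ: "P x + Q x = x" for x by (simp add: Q_def)
  have Pinv: "P (x + w) = P x" if "w \<in> W" for x w using that by (simp add: linear_add[OF P] Pw)
  have Qinv: "Q (x + v) = Q x" if "v \<in> V" for x v using that by (simp add: Q_def linear_add[OF P] Pv)
  have "dim V \<le> dim W" using V(2) W(2) by simp
  then obtain j where j: "linear j" "j \<in> V \<rightarrow> W" "\<And>x. x \<in> V \<Longrightarrow> norm (j x) = norm x"
    using isometry_subset_subspace[OF V(1) W(1)] by metis
  have jW: "j x \<in> W" if "x \<in> V" for x using j(2) that by auto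
  obtain K1 where K1: "K1 > 0" "\<And>x. norm (P x) \<le> norm x * K1"
    using bounded_linear.pos_bounded[OF linear_conv_bounded_linear[THEN iffD1, OF P]] by auto
  obtain K2 where K2: "K2 > 0" "\<And>x. norm (Q x) \<le> norm x * K2"
    using bounded_linear.pos_bounded[OF linear_conv_bounded_linear[THEN iffD1, OF Q]] by auto
  define K where "K = max K1 K2"
  have K: "0 < K" "\<And>x. norm (P x) \<le> K * norm x" "\<And>x. norm (Q x) \<le> K * norm x"
  proof -
    show "0 < K" using K1(1) by (simp add: K_def)
    fix x :: "(real, 'n) vec"
    have "norm x * K1 \<le> norm x * K" "norm x * K2 \<le> norm x * K"
      by (simp_all add: K_def mult_left_mono)
    then show "norm (P x) \<le> K * norm x" "norm (Q x) \<le> K * norm x"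
      using K1(2)[of x] K2(2)[of x] by (simp_all add: mult.commute[of K])
  qed
  have P_lip: "K-lipschitz_on UNIV P" and Q_lip: "K-lipschitz_on UNIV Q"
    using K by (auto simp: lipschitz_on_def dist_norm linear_diff[OF P, symmetric] linear_diff[OF Q, symmetric])
  obtain c where c: "0 < c" "\<And>x y w. x \<in> X \<union> Y \<Longrightarrow> y \<in> X \<union> Y \<Longrightarrow> w \<in> W \<Longrightarrow>
      c * norm (x - y) \<le> norm (x - y - w)"
    using avoid unfolding secants_avoid_def by auto
  have P_low: "norm (x - y) \<le> norm (P x - P y) / c" if "x \<in> X \<union> Y" "y \<in> X \<union> Y" for x y
  proof -
    have "c * norm (x - y) \<le> norm (x - y - Q (x - y))" by (rule c(2)[OF that QW])
    also have "x - y - Q (x - y) = P x - P y" by (simp add: Q_def linear_diff[OF P])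
    finally show ?thesis using c(1) by (simp add: field_simps)
  qed
  obtain M1 M2 where bij: "bij_betw f X Y" and M1: "M1-lipschitz_on X f"
    and M2: "M2-lipschitz_on Y (inv_into X f)"
    using f unfolding bilipschitz_homeomorphism_def by auto
  have fY: "f x \<in> Y" if "x \<in> X" for x using bij that by (auto simp: bij_betw_def)
  have f_up: "norm (f x - f y) \<le> M1 * norm (x - y)" if "x \<in> X" "y \<in> X" for x y
    by (rule lipschitz_on_normD[OF M1 that])
  have f_low: "norm (x - y) \<le> M2 * norm (f x - f y)" if "x \<in> X" "y \<in> X" for x y
    using lipschitz_on_normD[OF M2 fY[OF that(1)] fY[OF that(2)]] that
    by (simp add: bij_betw_inv_into_left[OF bij])
  have M: "0 \<le> M1" "0 \<le> M2" using M1 M2 by (simp_all add: lipschitz_on_nonneg)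
  have jP: "norm (j (P x) - j (P y)) = norm (P x - P y)" for x y
    using j(3)[OF subspace_diff[OF V(1) PV PV]] by (simp add: linear_diff[OF j(1)])
  \<comment> \<open>The first shear moves \<open>x\<close> to the point with components \<open>P x\<close> and \<open>j (P (f x))\<close>.\<close>
  have "\<exists>a C. C-lipschitz_on UNIV a \<and> (\<forall>x. a x \<in> W) \<and> (\<forall>x\<in>X. a (P x) = j (P (f x)) - Q x)"
  proof (rule lipschitz_extension_subspace[OF W(1)])
    show "j (P (f x)) - Q x \<in> W" if "x \<in> X" for x
      by (intro subspace_diff[OF W(1)] jW PV QW)
    fix x y assume xy: "x \<in> X" "y \<in> X"
    have "norm ((j (P (f x)) - Q x) - (j (P (f y)) - Q y))
        = norm ((j (P (f x)) - j (P (f y))) - Q (x - y))"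
      by (simp add: linear_diff[OF Q] algebra_simps)
    also have "\<dots> \<le> norm (P (f x - f y)) + norm (Q (x - y))"
      using norm_triangle_ineq4 by (simp add: linear_diff[OF P] jP[symmetric])
    also have "\<dots> \<le> K * (M1 * norm (x - y)) + K * norm (x - y)"
      using K(2)[of "f x - f y"] K(3)[of "x - y"] mult_left_mono[OF f_up[OF xy], of K] K(1) by linarith
    also have "\<dots> = K * (M1 + 1) * norm (x - y)" by (simp add: algebra_simps)
    also have "\<dots> \<le> K * (M1 + 1) * (norm (P x - P y) / c)"
      using P_low[of x y] xy K(1) M by (intro mult_left_mono) auto
    finally show "norm ((j (P (f x)) - Q x) - (j (P (f y)) - Q y)) \<le> K * (M1 + 1) / c * dist (P x) (P y)"
      by (simp add: dist_norm)
  qed (use K(1) M c(1) in simp)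
  then obtain a Ca where a: "Ca-lipschitz_on UNIV a" "\<And>x. a x \<in> W"
    "\<And>x. x \<in> X \<Longrightarrow> a (P x) = j (P (f x)) - Q x" by auto
  \<comment> \<open>The second shear moves the component in \<open>V\<close> from \<open>P x\<close> to \<open>P (f x)\<close>.\<close>
  have "\<exists>b C. C-lipschitz_on UNIV b \<and> (\<forall>x. b x \<in> V) \<and> (\<forall>x\<in>X. b (j (P (f x))) = P (f x) - P x)"
  proof (rule lipschitz_extension_subspace[OF V(1)])
    show "P (f x) - P x \<in> V" if "x \<in> X" for x by (intro subspace_diff[OF V(1)] PV)
    fix x y assume xy: "x \<in> X" "y \<in> X"
    have "norm ((P (f x) - P x) - (P (f y) - P y)) = norm (P (f x - f y) - P (x - y))"
      by (simp add: linear_diff[OF P] algebra_simps)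
    also have "\<dots> \<le> norm (P (f x - f y)) + norm (P (x - y))" by (rule norm_triangle_ineq4)
    also have "\<dots> \<le> K * norm (f x - f y) + K * (M2 * norm (f x - f y))"
      using K(2)[of "f x - f y"] K(2)[of "x - y"] mult_left_mono[OF f_low[OF xy], of K] K(1) by linarith
    also have "\<dots> = K * (M2 + 1) * norm (f x - f y)" by (simp add: algebra_simps)
    also have "\<dots> \<le> K * (M2 + 1) * (norm (P (f x) - P (f y)) / c)"
      using P_low[of "f x" "f y"] fY xy K(1) M by (intro mult_left_mono) auto
    finally show "norm ((P (f x) - P x) - (P (f y) - P y))
        \<le> K * (M2 + 1) / c * dist (j (P (f x))) (j (P (f y)))"
      by (simp add: dist_norm jP)
  qed (use K(1) M c(1) in simp)
  then obtain b Cb where b: "Cb-lipschitz_on UNIV b" "\<And>x. b x \<in> V"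
    "\<And>x. x \<in> X \<Longrightarrow> b (j (P (f x))) = P (f x) - P x" by auto
  \<comment> \<open>The third shear moves the component in \<open>W\<close> from \<open>j (P y)\<close> to \<open>Q y\<close>, for \<open>y = f x\<close>.\<close>
  have "\<exists>d C. C-lipschitz_on UNIV d \<and> (\<forall>x. d x \<in> W) \<and> (\<forall>y\<in>Y. d (P y) = Q y - j (P y))"
  proof (rule lipschitz_extension_subspace[OF W(1)])
    show "Q y - j (P y) \<in> W" if "y \<in> Y" for y
      by (intro subspace_diff[OF W(1)] jW PV QW)
    fix x y assume xy: "x \<in> Y" "y \<in> Y"
    have "norm ((Q x - j (P x)) - (Q y - j (P y))) = norm (Q (x - y) - (j (P x) - j (P y)))"
      by (simp add: linear_diff[OF Q] algebra_simps)
    also have "\<dots> \<le> norm (Q (x - y)) + norm (P (x - y))"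
      using norm_triangle_ineq4 by (simp add: linear_diff[OF P] jP[symmetric])
    also have "\<dots> \<le> 2 * K * norm (x - y)"
      using K(2)[of "x - y"] K(3)[of "x - y"] by linarith
    also have "\<dots> \<le> 2 * K * (norm (P x - P y) / c)"
      using P_low[of x y] xy K(1) by (intro mult_left_mono) auto
    finally show "norm ((Q x - j (P x)) - (Q y - j (P y))) \<le> 2 * K / c * dist (P x) (P y)"
      by (simp add: dist_norm)
  qed (use K(1) c(1) in simp)
  then obtain d Cd where d: "Cd-lipschitz_on UNIV d" "\<And>x. d x \<in> W"
    "\<And>y. y \<in> Y \<Longrightarrow> d (P y) = Q y - j (P y)" by auto
  define A where "A = (\<lambda>t x. x + t *\<^sub>R a (P x))"
  define B where "B = (\<lambda>t x. x + t *\<^sub>R b (Q x))"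
  define D where "D = (\<lambda>t x. x + t *\<^sub>R d (P x))"
  define F where "F = (\<lambda>t. D t \<circ> (B t \<circ> A t))"
  have shear: "tame_bilipschitz (\<lambda>x. x + t *\<^sub>R g (R x))"
    if U: "subspace U" "\<And>x. g x \<in> U" "\<And>x u. u \<in> U \<Longrightarrow> R (x + u) = R x"
      and g: "C-lipschitz_on UNIV g" and R: "K-lipschitz_on UNIV R"
    for g R :: "(real, 'n) vec \<Rightarrow> (real, 'n) vec" and U C t
  proof (rule tame_shear_subspace[OF n U(1)])
    have "(C * K)-lipschitz_on UNIV (g \<circ> R)"
      by (rule lipschitz_on_compose[OF R lipschitz_on_subset[OF g]]) auto
    then show "(\<bar>t\<bar> * (C * K))-lipschitz_on UNIV (\<lambda>x. t *\<^sub>R g (R x))"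
      using lipschitz_on_cmult[of "C * K" UNIV "g \<circ> R" t] by simp
    show "t *\<^sub>R g (R x) \<in> U" for x by (rule subspace_scale[OF U(1) U(2)])
    show "t *\<^sub>R g (R (x + u)) = t *\<^sub>R g (R x)" if "u \<in> U" for x u by (simp add: U(3)[OF that])
  qed
  have "tame_bilipschitz (A t)" "tame_bilipschitz (B t)" "tame_bilipschitz (D t)" for t
    unfolding A_def B_def D_def
    by (rule shear[OF W(1) a(2) Pinv a(1) P_lip] shear[OF V(1) b(2) Qinv b(1) Q_lip]
        shear[OF W(1) d(2) Pinv d(1) P_lip]; assumption)+
  then have "\<forall>t. tame_bilipschitz (F t)"
    unfolding F_def by (intro allI tame_bilipschitz_comp)
  moreover have "F 0 = id" by (auto simp: F_def A_def B_def D_def)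
  moreover have "F 1 x = f x" if x: "x \<in> X" for x
  proof -
    have "A 1 x = P x + j (P (f x))" using a(3)[OF x] by (simp add: A_def Q_def)
    moreover have jx: "j (P (f x)) \<in> W" by (intro jW PV)
    have "P (P x + j (P (f x))) = P x" by (simp add: Pinv[OF jx] Pv[OF PV])
    then have "Q (P x + j (P (f x))) = j (P (f x))" by (simp add: Q_def)
    then have "B 1 (P x + j (P (f x))) = P (f x) + j (P (f x))" using b(3)[OF x] by (simp add: B_def)
    moreover have "P (P (f x) + j (P (f x))) = P (f x)" by (simp add: Pinv[OF jx] Pv[OF PV])
    then have "D 1 (P (f x) + j (P (f x))) = f x"
      using d(3)[OF fY[OF x]] by (simp add: D_def Q_def)
    ultimately show ?thesis by (simp add: F_def)
  qed
  moreover have "continuous_on UNIV (\<lambda>(x, t). F t x)"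
  proof -
    have lin_cont: "continuous_on UNIV P" "continuous_on UNIV Q"
      using P_lip Q_lip lipschitz_on_continuous_on by blast+
    have cont: "continuous_on UNIV a" "continuous_on UNIV b" "continuous_on UNIV d"
      using a(1) b(1) d(1) lipschitz_on_continuous_on by blast+
    have step: "continuous_on UNIV (\<lambda>q. G q + snd q *\<^sub>R g (R (G q)))"
      if "continuous_on UNIV G" "continuous_on UNIV g" "continuous_on UNIV R"
      for G :: "(real, 'n) vec \<times> real \<Rightarrow> (real, 'n) vec" and g R :: "(real, 'n) vec \<Rightarrow> (real, 'n) vec"
      by (intro continuous_intros continuous_on_compose2[OF that(2)] continuous_on_compose2[OF that(3)] that(1)) auto
    have "continuous_on UNIV (\<lambda>q. D (snd q) (B (snd q) (A (snd q) (fst q))))"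
      unfolding A_def B_def D_def
      by (intro step cont lin_cont continuous_on_fst continuous_on_id)
    then show ?thesis by (simp add: F_def split_def)
  qed
  ultimately show ?thesis by (intro exI[of _ F]) auto
qed

theorem theorem3p7:
  fixes X Y :: "(real^'n::{finite,linorder}) set"
    and f :: "real^'n::{finite,linorder} \<Rightarrow> real^'n::{finite,linorder}"
    and k :: nat
  assumes "closed X" and "semialgebraic X" and "semialgebraic_dim X = ereal (real k)"
    and "closed Y" and "semialgebraic Y" and "semialgebraic_dim Y = ereal (real k)"
    and "bilipschitz_homeomorphism X Y f"
    and "CARD('n) \<ge> 4 * k + 2"
  shows "(\<exists>F. tame_bilipschitz F \<and> (\<forall>x\<in>X. F x = f x)) \<and>
         (\<exists>F :: real \<Rightarrow> real^'n::{finite,linorder} \<Rightarrow> real^'n::{finite,linorder}.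
            (\<forall>t. tame_bilipschitz (F t)) \<and>
            continuous_on UNIV (\<lambda>(x, t). F t x) \<and>
            F 0 = id \<and> (\<forall>x\<in>X. F 1 x = f x))"
proof -
  have "poly_growth (X \<union> Y) k"
    using assms(3,6) by (intro poly_growth_Un poly_growth_of_semialgebraic_dim) simp_all
  moreover have "(CARD('n) - (2 * k + 1)) + (2 * k + 1) \<le> DIM((real, 'n) vec)"
    using assms(8) by simp
  ultimately obtain W :: "(real, 'n) vec set" where W: "subspace W" "dim W = CARD('n) - (2 * k + 1)"
    "secants_avoid (X \<union> Y) W"
    using subspace_avoiding_secants_exists by blast
  have "2 \<le> CARD('n)" "CARD('n) \<le> 2 * dim W" using assms(8) W(2) by simp_all
  then obtain F :: "real \<Rightarrow> (real, 'n) vec \<Rightarrow> (real, 'n) vec" where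
    F: "\<forall>t. tame_bilipschitz (F t)" "continuous_on UNIV (\<lambda>(x, t). F t x)" "F 0 = id" "\<forall>x\<in>X. F 1 x = f x"
    using extension_by_three_shears[OF _ W(1) _ W(3) assms(7)] by auto
  then show ?thesis by (intro conjI exI[of _ "F 1"] exI[of _ F]) auto
qed

end
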